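(* Let $\rho>0$. Then there is a constant $\varepsilon=\varepsilon(\rho)>0$ such that if $\omega$ is Diophantine and $V\in C^a_\rho(\mathbb{T},\mathbb{R})$, with $|V|_\rho<\varepsilon$, is such that $\sigma(V,\omega)$ is a Cantor set, then there is a dense $G_\delta$ subset of $\sigma(V,\omega)$ such that for every energy $a$ in this subset the Schrödinger cocycle $(A_{a,V},\omega)$ is not reducible to constant coefficients (by a continuous transformation).
   Context: $\mathbb{T}=\mathbb{R}/(2\pi\mathbb{Z})$. For $\rho>0$, $C^a_\rho(\mathbb{T},\mathbb{R})$ is the set of real analytic functions $V:\mathbb{T}\to\mathbb{R}$ having an analytic extension to the strip $|\mathrm{Im}\,\theta|<\rho$ with $|V|_\rho:=\sup_{|\mathrm{Im}\,\theta|<\rho}|V(\theta)|<\infty$. A frequency $\omega\in\mathbb{R}$ is Diophantine if there exist $c>0$ and $\tau>1$ such that $|\sin 2\pi k\omega|>c/|k|^\tau$ for all $k\in\mathbb{Z}\setminus\{0\}$. $\sigma(V,\omega)\subset\mathbb{R}$ is the spectrum on $\ell^2(\mathbb{Z})$ of the Schrödinger operator $(H_{V,\omega,\phi}x)_n=x_{n+1}+x_{n-1}+V(2\pi\omega n+\phi)x_n$; it does not depend on $\phi\in\mathbb{T}$. A Cantor set is a nonempty compact subset of $\mathbb{R}$ that is perfect and nowhere dense. The Schrödinger cocycle $(A_{a,V},\omega)$ is given by $A_{a,V}(\theta)=\begin{pmatrix} a-V(\theta) & -1\\ 1 & 0\end{pmatrix}$, $\theta\in\mathbb{T}$. A cocycle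 $(A,\omega)$ on $SL(2,\mathbb{R})\times\mathbb{T}$ is reducible to constant coefficients (by a continuous transformation) if there are a constant matrix $B\in SL(2,\mathbb{R})$ and a continuous $Z:\mathbb{T}\to SL(2,\mathbb{R})$ with $A(\theta)Z(\theta)=Z(\theta+2\pi\omega)B$ for all $\theta\in\mathbb{T}$. *)

theory Defs
  imports "HOL-Analysis.Analysis"
begin

text \<open>
  Functions on the circle \<open>\<real> / 2\<pi>\<int>\<close> are represented by \<open>2\<pi>\<close>-periodic functions on the real line.
\<close>

definition circle_fun :: "(real \<Rightarrow> 'a) \<Rightarrow> bool" where
  "circle_fun f \<longleftrightarrow> (\<forall>\<theta>. f (\<theta> + 2 * pi) = f \<theta>)"

definition strip :: "real \<Rightarrow> complex set" where
  "strip \<rho> = {z. \<bar>Im z\<bar> < \<rho>}"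

text \<open>
  By the identity theorem, an extension as below is uniquely determined on the strip and is
  automatically \<open>2\<pi>\<close>-periodic there. Outside the strip it is arbitrary.
\<close>

definition is_strip_extension :: "real \<Rightarrow> (real \<Rightarrow> real) \<Rightarrow> (complex \<Rightarrow> complex) \<Rightarrow> bool" where
  "is_strip_extension \<rho> V F \<longleftrightarrow>
     F holomorphic_on strip \<rho> \<and> (\<forall>\<theta>. F (complex_of_real \<theta>) = complex_of_real (V \<theta>))"

definition strip_extension :: "real \<Rightarrow> (real \<Rightarrow> real) \<Rightarrow> complex \<Rightarrow> complex" where
  "strip_extension \<rho> V = (SOME F. is_strip_extension \<rho> V F)"

definition strip_norm :: "real \<Rightarrow> (real \<Rightarrow> real) \<Rightarrow> real" where
  "strip_norm \<rho> V = (SUP z\<in>strip \<rho>. cmod (strip_extension \<rho> V z))"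

definition analytic_strip_space :: "real \<Rightarrow> (real \<Rightarrow> real) set" where
  "analytic_strip_space \<rho> =
     {V. circle_fun V \<and> (\<exists>F. is_strip_extension \<rho> V F) \<and>
         bounded (strip_extension \<rho> V ` strip \<rho>)}"

definition diophantine :: "real \<Rightarrow> bool" where
  "diophantine \<omega> \<longleftrightarrow>
     (\<exists>c>0. \<exists>\<tau>>1. \<forall>k::int. k \<noteq> 0 \<longrightarrow>
        \<bar>sin (2 * pi * real_of_int k * \<omega>)\<bar> > c / \<bar>real_of_int k\<bar> powr \<tau>)"

definition ell2 :: "(int \<Rightarrow> complex) set" where
  "ell2 = {x. (\<lambda>n. (cmod (x n))\<^sup>2) summable_on UNIV}"

definition ell2_norm :: "(int \<Rightarrow> complex) \<Rightarrow> real" where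
  "ell2_norm x = sqrt (\<Sum>\<^sub>\<infinity>n. (cmod (x n))\<^sup>2)"

definition schrodinger_op ::
    "(real \<Rightarrow> real) \<Rightarrow> real \<Rightarrow> real \<Rightarrow> (int \<Rightarrow> complex) \<Rightarrow> int \<Rightarrow> complex" where
  "schrodinger_op V \<omega> \<phi> x n =
     x (n + 1) + x (n - 1) + complex_of_real (V (2 * pi * \<omega> * real_of_int n + \<phi>)) * x n"

text \<open>
  The resolvent set of a linear operator \<open>T\<close> on \<open>ell2\<close>: those \<open>z\<close> for which \<open>T - z\<close> is a bijection
  of \<open>ell2\<close> with bounded inverse.
\<close>

definition ell2_resolvent_set :: "((int \<Rightarrow> complex) \<Rightarrow> int \<Rightarrow> complex) \<Rightarrow> complex set" where
  "ell2_resolvent_set T =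
     {z. bij_betw (\<lambda>x n. T x n - z * x n) ell2 ell2 \<and>
         (\<exists>C. \<forall>y\<in>ell2. ell2_norm (inv_into ell2 (\<lambda>x n. T x n - z * x n) y) \<le> C * ell2_norm y)}"

definition ell2_spectrum :: "((int \<Rightarrow> complex) \<Rightarrow> int \<Rightarrow> complex) \<Rightarrow> complex set" where
  "ell2_spectrum T = - ell2_resolvent_set T"

text \<open>
  For bounded \<open>V\<close> the operator is bounded and self-adjoint, so its spectrum is real and
  nothing is lost by recording it as a set of real numbers.
\<close>

definition schrodinger_spectrum :: "(real \<Rightarrow> real) \<Rightarrow> real \<Rightarrow> real \<Rightarrow> real set" where
  "schrodinger_spectrum V \<omega> \<phi> = {a. complex_of_real a \<in> ell2_spectrum (schrodinger_op V \<omega> \<phi>)}"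

definition cantor_set :: "real set \<Rightarrow> bool" where
  "cantor_set S \<longleftrightarrow>
     S \<noteq> {} \<and> compact S \<and> (\<forall>x\<in>S. x islimpt S) \<and> interior (closure S) = {}"

definition SL2 :: "(real^2^2) set" where
  "SL2 = {M. det M = 1}"

definition schrodinger_cocycle :: "real \<Rightarrow> (real \<Rightarrow> real) \<Rightarrow> real \<Rightarrow> real^2^2" where
  "schrodinger_cocycle a V \<theta> = vector [vector [a - V \<theta>, -1], vector [1, 0]]"

definition reducible_cocycle :: "(real \<Rightarrow> real^2^2) \<Rightarrow> real \<Rightarrow> bool" where
  "reducible_cocycle A \<omega> \<longleftrightarrow>
     (\<exists>B\<in>SL2. \<exists>Z. circle_fun Z \<and> continuous_on UNIV Z \<and> range Z \<subseteq> SL2 \<and>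
        (\<forall>\<theta>. A \<theta> ** Z \<theta> = Z (\<theta> + 2 * pi * \<omega>) ** B))"

end

theory Submission
  imports Defs
begin

text \<open>
  A reducible cocycle is conjugate to a constant matrix \<open>B\<close> of determinant 1, and the trace of \<open>B\<close>
  decides what reducibility means for the equation \<open>H x = a x\<close>.

  If \<open>B\<close> is hyperbolic, the equation has an exponential dichotomy, \<open>H - a\<close> is invertible, and \<open>a\<close> is
  not in the spectrum (\<open>floquet_pair_resolvent\<close>).

  If \<open>B\<close> has trace 2 or -2, an eigenvector of \<open>B\<close> gives a continuous function on the circle that is
  an eigenfunction, with eigenvalue \<open>a\<close>, of a symmetric operator. Eigenfunctions of different
  eigenvalues are orthogonal, so this happens for countably many \<open>a\<close> only
  (\<open>countable_twisted_eigenvalues\<close>).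

  If \<open>B\<close> is elliptic, all solutions are bounded (\<open>elliptic_reducible_bounded\<close>).

  Hence it suffices to find a dense \<open>G\<^sub>\<delta>\<close> set of energies in the spectrum that have an unbounded
  solution: as the spectrum is perfect, a countable set can then be removed by the Baire category
  theorem. Unboundedness is a \<open>G\<^sub>\<delta>\<close> condition because solutions at a given site are continuous in
  the energy. The heart of the proof is density. The spectrum is nowhere dense, so the edges
  of its gaps are dense in it, and at a gap edge not all solutions can be bounded
  (\<open>bounded_solution_excludes_gap_edge\<close>). Indeed, two independent bounded real solutions combine to a
  bounded complex solution with a nonzero current. Modulating it by a slow phase produces
  approximate solutions whose energy moves, at first order in the speed of the phase, to the
  side of \<open>a\<close> that one chooses; so there is spectrum arbitrarily close to \<open>a\<close> on both sides.
\<close>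

section \<open>The Schroedinger operator on square summable sequences\<close>

text \<open>
  The Schroedinger operator minus an energy \<open>a\<close> is again of this form, with potential \<open>w - a\<close>;
  so spectral shifts are shifts of the potential and need no separate operator.
\<close>

definition jacobi :: "(int \<Rightarrow> real) \<Rightarrow> (int \<Rightarrow> complex) \<Rightarrow> int \<Rightarrow> complex" where
  "jacobi w x n = x (n + 1) + x (n - 1) + complex_of_real (w n) * x n"

text \<open>
  The real part of the usual scalar product. The operator is real, so its quadratic form
  is already determined by this real scalar product.
\<close>

definition ell2_inner :: "(int \<Rightarrow> complex) \<Rightarrow> (int \<Rightarrow> complex) \<Rightarrow> real" where
  "ell2_inner x y = (\<Sum>\<^sub>\<infinity>n. x n \<bullet> y n)"

abbreviation energy :: "(int \<Rightarrow> complex) \<Rightarrow> real" where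
  "energy x \<equiv> ell2_inner x x"

lemma ell2_dominated:
  assumes "x \<in> ell2" and "\<And>n. cmod (y n) \<le> C * cmod (x n)"
  shows "y \<in> ell2"
proof -
  have "(\<lambda>n. C\<^sup>2 * (cmod (x n))\<^sup>2) summable_on UNIV"
    using assms(1) unfolding ell2_def by (intro summable_on_cmult_right) auto
  then have "(\<lambda>n. (cmod (y n))\<^sup>2) summable_on UNIV"
  proof (rule summable_on_comparison_test)
    fix n show "(cmod (y n))\<^sup>2 \<le> C\<^sup>2 * (cmod (x n))\<^sup>2"
      using power_mono[OF assms(2)[of n], of 2] by (simp add: power_mult_distrib)
  qed auto
  then show ?thesis unfolding ell2_def by simp
qed

lemma ell2_mult_bounded:
  assumes "x \<in> ell2" and "\<And>n. cmod (c n) \<le> C"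
  shows "(\<lambda>n. c n * x n) \<in> ell2"
  by (rule ell2_dominated[OF assms(1), of _ C])
     (use assms(2) in \<open>auto simp: norm_mult intro: mult_right_mono\<close>)

lemma cmod_add_sq_le: "(cmod (a + b))\<^sup>2 \<le> 2 * (cmod a)\<^sup>2 + 2 * (cmod b)\<^sup>2"
proof -
  have "(cmod (a + b))\<^sup>2 \<le> (cmod a + cmod b)\<^sup>2"
    by (intro power_mono norm_triangle_ineq) auto
  also have "\<dots> \<le> 2 * (cmod a)\<^sup>2 + 2 * (cmod b)\<^sup>2"
    using sum_squares_bound[of "cmod a" "cmod b"] by (simp add: power2_sum)
  finally show ?thesis .
qed

lemma ell2_add:
  assumes "x \<in> ell2" "y \<in> ell2"
  shows "(\<lambda>n. x n + y n) \<in> ell2"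
proof -
  have "(\<lambda>n. 2 * (cmod (x n))\<^sup>2 + 2 * (cmod (y n))\<^sup>2) summable_on UNIV"
    using assms unfolding ell2_def
    by (intro summable_on_add summable_on_cmult_right) auto
  then have "(\<lambda>n. (cmod (x n + y n))\<^sup>2) summable_on UNIV"
    by (rule summable_on_comparison_test) (auto simp: cmod_add_sq_le)
  then show ?thesis unfolding ell2_def by simp
qed

lemma bij_shift: "bij (\<lambda>n::int. n + k)"
  by (rule bij_betw_byWitness[where f' = "\<lambda>n. n - k"]) auto

lemma bij_reflect: "bij (\<lambda>n::int. k - n)"
  by (rule bij_betw_byWitness[where f' = "\<lambda>n. k - n"]) auto

lemma ell2_reindex:
  assumes "bij h"
  shows "(\<lambda>n. x (h n)) \<in> ell2 \<longleftrightarrow> x \<in> ell2"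
  unfolding ell2_def
  using summable_on_reindex_bij_betw[OF assms, of "\<lambda>n. (cmod (x n))\<^sup>2"] by simp

lemma ell2_shift: "x \<in> ell2 \<Longrightarrow> (\<lambda>n. x (n + k)) \<in> ell2"
  using ell2_reindex[OF bij_shift] by blast

lemma ell2_inner_summable:
  assumes "x \<in> ell2" "y \<in> ell2"
  shows "(\<lambda>n. x n \<bullet> y n) summable_on UNIV"
proof -
  have "(\<lambda>n. (cmod (x n))\<^sup>2 + (cmod (y n))\<^sup>2) summable_on UNIV"
    using assms unfolding ell2_def by (intro summable_on_add) auto
  then have "(\<lambda>n. norm (x n \<bullet> y n)) summable_on UNIV"
  proof (rule Infinite_Sum.abs_summable_on_comparison_test')
    fix n
    have "\<bar>x n \<bullet> y n\<bar> \<le> cmod (x n) * cmod (y n)"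
      by (rule Cauchy_Schwarz_ineq2)
    also have "\<dots> \<le> (cmod (x n))\<^sup>2 + (cmod (y n))\<^sup>2"
    proof -
      have "2 * (cmod (x n) * cmod (y n)) \<le> (cmod (x n))\<^sup>2 + (cmod (y n))\<^sup>2"
        using sum_squares_bound[of "cmod (x n)" "cmod (y n)"] by simp
      moreover have "0 \<le> cmod (x n) * cmod (y n)" by simp
      ultimately show ?thesis by linarith
    qed
    finally show "norm (x n \<bullet> y n) \<le> (cmod (x n))\<^sup>2 + (cmod (y n))\<^sup>2" by simp
  qed
  then show ?thesis by (rule abs_summable_summable)
qed

lemma energy_eq: "energy x = (\<Sum>\<^sub>\<infinity>n. (cmod (x n))\<^sup>2)"
  unfolding ell2_inner_def by (simp add: power2_norm_eq_inner)

lemma energy_nonneg: "energy x \<ge> 0"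
  unfolding energy_eq by (intro infsum_nonneg) auto

lemma ell2_norm_sq: "(ell2_norm x)\<^sup>2 = energy x"
  unfolding ell2_norm_def energy_eq[symmetric] using energy_nonneg by simp

lemma energy_reindex:
  assumes "bij h"
  shows "energy (\<lambda>n. x (h n)) = energy x"
  unfolding ell2_inner_def
  using infsum_reindex_bij_betw[OF assms, of "\<lambda>n. x n \<bullet> x n"] by simp

lemma energy_dominated:
  assumes "x \<in> ell2" and "\<And>n. cmod (y n) \<le> C * cmod (x n)"
  shows "energy y \<le> C\<^sup>2 * energy x"
proof -
  have y: "y \<in> ell2" by (rule ell2_dominated[OF assms])
  have "energy y \<le> (\<Sum>\<^sub>\<infinity>n. C\<^sup>2 * (cmod (x n))\<^sup>2)"
    unfolding energy_eq
  proof (rule infsum_mono)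
    show "(\<lambda>n. (cmod (y n))\<^sup>2) summable_on UNIV" using y by (simp add: ell2_def)
    show "(\<lambda>n. C\<^sup>2 * (cmod (x n))\<^sup>2) summable_on UNIV"
      using assms(1) unfolding ell2_def by (intro summable_on_cmult_right) auto
    fix n show "(cmod (y n))\<^sup>2 \<le> C\<^sup>2 * (cmod (x n))\<^sup>2"
      using power_mono[OF assms(2)[of n], of 2] by (simp add: power_mult_distrib)
  qed
  also have "\<dots> = C\<^sup>2 * energy x"
    unfolding energy_eq using assms(1) unfolding ell2_def
    by (intro infsum_cmult_right) auto
  finally show ?thesis .
qed

lemma energy_mult_bounded:
  assumes "x \<in> ell2" and "\<And>n. cmod (c n) \<le> C"
  shows "energy (\<lambda>n. c n * x n) \<le> C\<^sup>2 * energy x"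
  by (rule energy_dominated[OF assms(1)])
     (use assms(2) in \<open>auto simp: norm_mult intro: mult_right_mono\<close>)

lemma energy_add_scaled:
  assumes "x \<in> ell2" "y \<in> ell2"
  shows "energy (\<lambda>n. x n + t *\<^sub>R y n) = energy x + 2 * t * ell2_inner x y + t\<^sup>2 * energy y"
proof -
  have "(x n + t *\<^sub>R y n) \<bullet> (x n + t *\<^sub>R y n)
      = (x n \<bullet> x n + (2 * t) * (x n \<bullet> y n)) + t\<^sup>2 * (y n \<bullet> y n)" for n
    by (simp add: inner_add inner_commute algebra_simps power2_eq_square)
  then have "energy (\<lambda>n. x n + t *\<^sub>R y n)
      = (\<Sum>\<^sub>\<infinity>n. (x n \<bullet> x n + (2 * t) * (x n \<bullet> y n)) + t\<^sup>2 * (y n \<bullet> y n))"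
    unfolding ell2_inner_def by simp
  also have "\<dots> = energy x + 2 * t * ell2_inner x y + t\<^sup>2 * energy y"
    unfolding ell2_inner_def using assms
    by (simp add: infsum_add infsum_cmult_right ell2_inner_summable summable_on_add
        summable_on_cmult_right)
  finally show ?thesis .
qed

lemma energy_add_le:
  assumes "x \<in> ell2" "y \<in> ell2"
  shows "energy (\<lambda>n. x n + y n) \<le> 2 * energy x + 2 * energy y"
proof -
  have "energy (\<lambda>n. x n + y n) + energy (\<lambda>n. x n + (-1) *\<^sub>R y n) = 2 * energy x + 2 * energy y"
    using energy_add_scaled[OF assms, of 1] energy_add_scaled[OF assms, of "-1"] by simp
  then show ?thesis using energy_nonneg[of "\<lambda>n. x n + (-1) *\<^sub>R y n"] by linarith
qed

lemma ell2_scaleR: "x \<in> ell2 \<Longrightarrow> (\<lambda>n. t *\<^sub>R x n) \<in> ell2"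
  by (rule ell2_dominated[of x _ "\<bar>t\<bar>"]) auto

lemma jacobi_ell2:
  assumes "x \<in> ell2" and "\<And>n. \<bar>w n\<bar> \<le> C"
  shows "jacobi w x \<in> ell2"
proof -
  have "(\<lambda>n. x (n + 1) + x (n + (-1)) + complex_of_real (w n) * x n) \<in> ell2"
    by (intro ell2_add ell2_shift assms ell2_mult_bounded[where C = C]) (auto simp: assms(2))
  then show ?thesis unfolding jacobi_def[abs_def] by simp
qed

lemma jacobi_symmetric:
  assumes x: "x \<in> ell2" and y: "y \<in> ell2" and w: "\<And>n. \<bar>w n\<bar> \<le> C"
  shows "ell2_inner (jacobi w x) y = ell2_inner x (jacobi w y)"
proof -
  have wx: "(\<lambda>n. complex_of_real (w n) * x n) \<in> ell2" by (intro ell2_mult_bounded[where C = C] x) (auto simp: w)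
  have x1: "(\<lambda>n. x (n + 1)) \<in> ell2" "(\<lambda>n. x (n - 1)) \<in> ell2"
    using ell2_shift[OF x, of 1] ell2_shift[OF x, of "-1"] by auto
  have y1: "(\<lambda>n. y (n + 1)) \<in> ell2" "(\<lambda>n. y (n - 1)) \<in> ell2"
    using ell2_shift[OF y, of 1] ell2_shift[OF y, of "-1"] by auto
  have wc: "(complex_of_real (w n) * x n) \<bullet> y n = x n \<bullet> (complex_of_real (w n) * y n)" for n
    by (simp add: inner_complex_def algebra_simps)
  have wy: "(\<lambda>n. complex_of_real (w n) * y n) \<in> ell2" by (intro ell2_mult_bounded[where C = C] y) (auto simp: w)
  have s1: "(\<Sum>\<^sub>\<infinity>n. x (n + 1) \<bullet> y n) = (\<Sum>\<^sub>\<infinity>n. x n \<bullet> y (n - 1))"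
    using infsum_reindex_bij_betw[OF bij_shift[of 1], of "\<lambda>n. x n \<bullet> y (n - 1)"] by simp
  have s2: "(\<Sum>\<^sub>\<infinity>n. x (n - 1) \<bullet> y n) = (\<Sum>\<^sub>\<infinity>n. x n \<bullet> y (n + 1))"
    using infsum_reindex_bij_betw[OF bij_shift[of "-1"], of "\<lambda>n. x n \<bullet> y (n + 1)"] by simp
  have "ell2_inner (jacobi w x) y
      = (\<Sum>\<^sub>\<infinity>n. (x (n + 1) \<bullet> y n + x (n - 1) \<bullet> y n) + (complex_of_real (w n) * x n) \<bullet> y n)"
    unfolding ell2_inner_def jacobi_def by (simp add: inner_add_left)
  also have "\<dots> = (\<Sum>\<^sub>\<infinity>n. x (n + 1) \<bullet> y n) + (\<Sum>\<^sub>\<infinity>n. x (n - 1) \<bullet> y n)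
      + (\<Sum>\<^sub>\<infinity>n. (complex_of_real (w n) * x n) \<bullet> y n)"
    by (subst infsum_add infsum_add; (intro summable_on_add ell2_inner_summable x1 y wx)?)+ simp
  also have "\<dots> = (\<Sum>\<^sub>\<infinity>n. x n \<bullet> y (n + 1)) + (\<Sum>\<^sub>\<infinity>n. x n \<bullet> y (n - 1))
      + (\<Sum>\<^sub>\<infinity>n. x n \<bullet> (complex_of_real (w n) * y n))"
    unfolding s1 s2 wc by simp
  also have "\<dots> = (\<Sum>\<^sub>\<infinity>n. (x n \<bullet> y (n + 1) + x n \<bullet> y (n - 1)) + x n \<bullet> (complex_of_real (w n) * y n))"
    by (subst infsum_add infsum_add; (intro summable_on_add ell2_inner_summable x y1 wy)?)+ simp
  also have "\<dots> = ell2_inner x (jacobi w y)"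
    unfolding ell2_inner_def jacobi_def by (simp add: inner_add_right)
  finally show ?thesis .
qed

lemma jacobi_bounded:
  assumes w: "\<And>n. \<bar>w n\<bar> \<le> C" and x: "x \<in> ell2"
  shows "energy (jacobi w x) \<le> (8 + 2 * C\<^sup>2) * energy x"
proof -
  have x1: "(\<lambda>n. x (n + 1)) \<in> ell2" "(\<lambda>n. x (n - 1)) \<in> ell2"
    using ell2_shift[OF x, of 1] ell2_shift[OF x, of "-1"] by auto
  have e1: "energy (\<lambda>n. x (n + 1)) = energy x" "energy (\<lambda>n. x (n - 1)) = energy x"
    using energy_reindex[OF bij_shift[of 1], of x] energy_reindex[OF bij_shift[of "-1"], of x] by auto
  have c: "cmod (complex_of_real (w n) * x n) \<le> C * cmod (x n)" for n
    using w[of n] by (simp add: norm_mult mult_right_mono)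
  note wx = ell2_dominated[OF x c]
  have "energy (jacobi w x) \<le> 2 * energy (\<lambda>n. x (n + 1) + x (n - 1)) + 2 * energy (\<lambda>n. complex_of_real (w n) * x n)"
    unfolding jacobi_def[abs_def] by (intro energy_add_le ell2_add x1 wx)
  also have "\<dots> \<le> 2 * (2 * energy x + 2 * energy x) + 2 * (C\<^sup>2 * energy x)"
    using energy_add_le[OF x1] energy_dominated[OF x c] unfolding e1
    by (intro add_mono mult_left_mono) auto
  finally show ?thesis by (simp add: algebra_simps)
qed

text \<open>
  For a self-adjoint operator the norm of the resolvent is the inverse of the distance to the
  spectrum; here is the part of that fact that gives a lower bound across a gap of radius \<open>r\<close>.
  Write \<open>S = jacobi w\<close> and let \<open>\<mu> = m\<^sup>2\<close> be the infimum of the quotient of \<open>energy (S x)\<close> by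
  \<open>energy x\<close>. The form of \<open>S\<^sup>2 - \<mu>\<close> is nonnegative, so a near-minimizer \<open>x\<close> of the quotient
  makes \<open>(S\<^sup>2 - \<mu>) x = (S + m) (S - m) x\<close> small. If \<open>m < r\<close>, both factors are bounded below,
  which is a contradiction.
\<close>

lemma jacobi_lower_bound_from_gap:
  fixes w :: "int \<Rightarrow> real"
  assumes w: "\<And>n. \<bar>w n\<bar> \<le> C"
    and gap: "\<And>s. \<bar>s\<bar> < r \<Longrightarrow> \<exists>k>0. \<forall>x\<in>ell2. k * energy x \<le> energy (jacobi (\<lambda>n. w n - s) x)"
    and r: "r > 0" and z: "z \<in> ell2"
  shows "r\<^sup>2 * energy z \<le> energy (jacobi w z)"
proof (rule ccontr)
  assume "\<not> ?thesis"
  then have zlt: "energy (jacobi w z) < r\<^sup>2 * energy z" by simp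
  have zpos: "energy z > 0"
    using zlt energy_nonneg[of "jacobi w z"] energy_nonneg[of z] by (cases "energy z = 0") auto
  define R where "R = {energy (jacobi w x) / energy x | x. x \<in> ell2 \<and> energy x > 0}"
  define \<mu> where "\<mu> = Inf R"
  have Rnn: "t \<ge> 0" if "t \<in> R" for t using that energy_nonneg unfolding R_def by auto
  have Rbdd: "bdd_below R" using Rnn by (meson bdd_below.I)
  have zR: "energy (jacobi w z) / energy z \<in> R" using z zpos unfolding R_def by auto
  have \<mu>0: "\<mu> \<ge> 0" unfolding \<mu>_def using zR Rnn by (intro cInf_greatest) auto
  have "\<mu> \<le> energy (jacobi w z) / energy z" unfolding \<mu>_def using zR Rbdd by (rule cInf_lower)
  also have "\<dots> < r\<^sup>2" using zlt zpos by (simp add: field_simps)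
  finally have \<mu>r: "\<mu> < r\<^sup>2" .
  have low: "\<mu> * energy x \<le> energy (jacobi w x)" if x: "x \<in> ell2" for x
  proof (cases "energy x > 0")
    case True
    then have "energy (jacobi w x) / energy x \<in> R" using x unfolding R_def by auto
    then have "\<mu> \<le> energy (jacobi w x) / energy x" unfolding \<mu>_def using Rbdd by (rule cInf_lower)
    then show ?thesis using True by (simp add: field_simps)
  next
    case False
    then have "energy x = 0" using energy_nonneg[of x] by simp
    then show ?thesis using energy_nonneg[of "jacobi w x"] by simp
  qed
  define m where "m = sqrt \<mu>"
  have m: "m\<^sup>2 = \<mu>" "m \<ge> 0" using \<mu>0 by (auto simp: m_def)
  have mr: "\<bar>m\<bar> < r" using \<mu>r m r by (metis abs_of_nonneg power2_less_imp_less less_imp_le)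
  obtain k1 where k1: "k1 > 0" "\<And>x. x \<in> ell2 \<Longrightarrow> k1 * energy x \<le> energy (jacobi (\<lambda>n. w n - m) x)"
    using gap[OF mr] by blast
  have mr': "\<bar>-m\<bar> < r" using mr by simp
  obtain k2 where k2: "k2 > 0" "\<And>x. x \<in> ell2 \<Longrightarrow> k2 * energy x \<le> energy (jacobi (\<lambda>n. w n - (-m)) x)"
    using gap[OF mr'] by blast
  define M where "M = 8 + 2 * C\<^sup>2"
  have M: "M > 0" "\<And>x. x \<in> ell2 \<Longrightarrow> energy (jacobi w x) \<le> M * energy x"
    using jacobi_bounded[of w C] w by (auto simp: M_def add_pos_nonneg)
  \<comment> \<open>The near-minimizer is chosen with an error too small for the two lower bounds
    \<open>k1\<close>, \<open>k2\<close>: by the estimate below, \<open>energy y \<le> M * \<eta> * energy x\<close> with \<open>y = (S\<^sup>2 - \<mu>) x\<close>.\<close>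
  define \<eta> where "\<eta> = k1 * k2 / (2 * M)"
  have \<eta>: "\<eta> > 0" using k1 k2 M by (simp add: \<eta>_def)
  have "\<exists>t\<in>R. t < \<mu> + \<eta>"
    using cInf_lessD[of R "\<mu> + \<eta>"] zR \<eta> unfolding \<mu>_def by auto
  then obtain x where x: "x \<in> ell2" "energy x > 0" and xe: "energy (jacobi w x) / energy x < \<mu> + \<eta>"
    unfolding R_def by auto
  have near: "energy (jacobi w x) - \<mu> * energy x < \<eta> * energy x"
    using xe x by (simp add: field_simps)
  define y where "y = (\<lambda>n. jacobi w (jacobi w x) n + (-\<mu>) *\<^sub>R x n)"
  have Jx: "jacobi w x \<in> ell2" using jacobi_ell2[OF x(1) w] .
  have JJx: "jacobi w (jacobi w x) \<in> ell2" using jacobi_ell2[OF Jx w] .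
  have y: "y \<in> ell2" unfolding y_def by (intro ell2_add ell2_scaleR JJx x)
  have Jy: "jacobi w y \<in> ell2" using jacobi_ell2[OF y w] .
  define a where "a = jacobi (\<lambda>n. w n - m) x"
  have wm: "\<bar>w n - m\<bar> \<le> C + \<bar>m\<bar>" "\<bar>w n + m\<bar> \<le> C + \<bar>m\<bar>" for n using w[of n] by linarith+
  have a: "a \<in> ell2" unfolding a_def by (rule jacobi_ell2[OF x(1) wm(1)])
  have fac: "y = jacobi (\<lambda>n. w n - (-m)) a"
    unfolding y_def a_def jacobi_def[abs_def] m(1)[symmetric]
    by (rule ext) (simp add: algebra_simps scaleR_conv_of_real power2_eq_square)
  have ylow: "k1 * k2 * energy x \<le> energy y"
  proof -
    have "k1 * k2 * energy x = k2 * (k1 * energy x)" by simp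
    also have "\<dots> \<le> k2 * energy a" using k1(2)[OF x(1)] k2(1) unfolding a_def by simp
    also have "\<dots> \<le> energy y" unfolding fac by (rule k2(2)[OF a])
    finally show ?thesis .
  qed
  \<comment> \<open>Testing the nonnegative form of \<open>S\<^sup>2 - \<mu>\<close> on \<open>x + t y\<close> gives a quadratic in \<open>t\<close>;
    \<open>t = - 1 / M\<close> is the value that makes its linear term win.\<close>
  define t where "t = - 1 / M"
  define u where "u = (\<lambda>n. x n + t *\<^sub>R y n)"
  have u: "u \<in> ell2" unfolding u_def by (intro ell2_add ell2_scaleR x y)
  have Ju: "jacobi w u = (\<lambda>n. jacobi w x n + t *\<^sub>R jacobi w y n)"
    unfolding u_def jacobi_def by (rule ext) (simp add: algebra_simps scaleR_conv_of_real)
  have e1: "energy (jacobi w u) = energy (jacobi w x) + 2 * t * ell2_inner (jacobi w x) (jacobi w y) + t\<^sup>2 * energy (jacobi w y)"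
    unfolding Ju by (rule energy_add_scaled[OF Jx Jy])
  have e2: "energy u = energy x + 2 * t * ell2_inner x y + t\<^sup>2 * energy y"
    unfolding u_def by (rule energy_add_scaled[OF x(1) y])
  have cross: "ell2_inner (jacobi w x) (jacobi w y) - \<mu> * ell2_inner x y = energy y"
  proof -
    have "ell2_inner (jacobi w x) (jacobi w y) = ell2_inner (jacobi w (jacobi w x)) y"
      using jacobi_symmetric[OF Jx y w] by simp
    moreover have "energy y = ell2_inner (jacobi w (jacobi w x)) y - \<mu> * ell2_inner x y"
    proof -
      have "y n \<bullet> y n = jacobi w (jacobi w x) n \<bullet> y n + (-\<mu>) * (x n \<bullet> y n)" for n
        by (subst (1) y_def) (simp add: inner_diff_left)
      then have "energy y = (\<Sum>\<^sub>\<infinity>n. jacobi w (jacobi w x) n \<bullet> y n + (-\<mu>) * (x n \<bullet> y n))"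
        unfolding ell2_inner_def by simp
      also have "\<dots> = ell2_inner (jacobi w (jacobi w x)) y + (-\<mu>) * ell2_inner x y"
        unfolding ell2_inner_def using ell2_inner_summable[OF JJx y] ell2_inner_summable[OF x(1) y]
        by (subst infsum_add) (auto simp: infsum_cmult_right summable_on_cmult_right infsum_uminus summable_on_uminus)
      finally show ?thesis by simp
    qed
    ultimately show ?thesis by simp
  qed
  have "0 \<le> energy (jacobi w u) - \<mu> * energy u" using low[OF u] by simp
  also have "\<dots> = (energy (jacobi w x) - \<mu> * energy x)
      + 2 * t * (ell2_inner (jacobi w x) (jacobi w y) - \<mu> * ell2_inner x y)
      + t\<^sup>2 * (energy (jacobi w y) - \<mu> * energy y)"
    unfolding e1 e2 by (simp add: algebra_simps)
  also have "\<dots> \<le> (energy (jacobi w x) - \<mu> * energy x) + 2 * t * energy y + t\<^sup>2 * (M * energy y)"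
    unfolding cross using M(2)[OF y] \<mu>0 energy_nonneg[of y]
    by (intro add_left_mono mult_left_mono) (auto intro: order_trans[of _ "energy (jacobi w y)"])
  also have "\<dots> = (energy (jacobi w x) - \<mu> * energy x) - energy y / M"
    using M(1) by (simp add: t_def field_simps power2_eq_square)
  finally have "energy y / M \<le> energy (jacobi w x) - \<mu> * energy x" by simp
  then have "energy y / M < \<eta> * energy x" using near by linarith
  then have "energy y < k1 * k2 * energy x / 2"
    using M(1) by (simp add: \<eta>_def field_simps)
  then have "k1 * k2 * energy x < k1 * k2 * energy x / 2" using ylow by linarith
  moreover have "k1 * k2 * energy x > 0" using k1 k2 x by simp
  ultimately show False by linarith
qed

section \<open>Bounded solutions and gap edges\<close>

lemma resolvent_bounded_below:
  assumes "complex_of_real a \<in> ell2_resolvent_set (jacobi v)"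
  shows "\<exists>k>0. \<forall>x\<in>ell2. k * energy x \<le> energy (jacobi (\<lambda>n. v n - a) x)"
proof -
  have eq: "(\<lambda>x n. jacobi v x n - complex_of_real a * x n) = jacobi (\<lambda>n. v n - a)"
    unfolding jacobi_def by (intro ext) (simp add: algebra_simps)
  let ?S = "jacobi (\<lambda>n. v n - a)"
  have bij: "bij_betw ?S ell2 ell2"
    and "\<exists>C. \<forall>y\<in>ell2. ell2_norm (inv_into ell2 ?S y) \<le> C * ell2_norm y"
    using assms unfolding ell2_resolvent_set_def mem_Collect_eq eq by blast+
  then obtain C where C: "\<And>y. y \<in> ell2 \<Longrightarrow> ell2_norm (inv_into ell2 ?S y) \<le> C * ell2_norm y"
    by blast
  define B where "B = \<bar>C\<bar> + 1"
  have B: "B > 0" by (simp add: B_def)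
  show ?thesis
  proof (intro exI[of _ "1 / B\<^sup>2"] conjI ballI)
    fix x assume x: "x \<in> ell2"
    have "?S x \<in> ell2" using bij x by (rule bij_betw_apply)
    then have "ell2_norm (inv_into ell2 ?S (?S x)) \<le> C * ell2_norm (?S x)" by (rule C)
    then have "ell2_norm x \<le> C * ell2_norm (?S x)"
      using bij x by (simp add: bij_betw_inv_into_left)
    also have "\<dots> \<le> B * ell2_norm (?S x)"
      by (rule mult_right_mono) (auto simp: B_def ell2_norm_def intro!: infsum_nonneg)
    finally have "(ell2_norm x)\<^sup>2 \<le> (B * ell2_norm (?S x))\<^sup>2"
      by (rule power_mono) (auto simp: ell2_norm_def intro!: infsum_nonneg)
    then show "1 / B\<^sup>2 * energy x \<le> energy (?S x)"
      using B by (simp add: power_mult_distrib ell2_norm_sq field_simps)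
  qed (use B in auto)
qed

lemma energy_finite_support:
  assumes "finite F" "\<And>n. n \<notin> F \<Longrightarrow> x n = 0"
  shows "x \<in> ell2" "energy x = (\<Sum>n\<in>F. (cmod (x n))\<^sup>2)"
proof -
  show "x \<in> ell2" unfolding ell2_def mem_Collect_eq
    by (rule finite_nonzero_values_imp_summable_on)
       (use assms in \<open>auto intro: finite_subset[of _ F]\<close>)
  have "energy x = (\<Sum>\<^sub>\<infinity>n\<in>F. (cmod (x n))\<^sup>2)"
    unfolding energy_eq by (rule infsum_cong_neutral) (use assms in auto)
  then show "energy x = (\<Sum>n\<in>F. (cmod (x n))\<^sup>2)" using assms(1) by simp
qed

text \<open>
  Cut off \<open>p\<close> outside \<open>[-L, L]\<close>. The operator sees the cut at four sites only, at a cost that does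
  not depend on \<open>L\<close>, while the deficit \<open>\<eta>\<close> is collected at each of the sites in between.
  This is what allows bounded sequences to serve as test vectors.
\<close>

lemma lower_bound_excludes_subsolution:
  fixes w :: "int \<Rightarrow> real"
  assumes low: "\<And>x. x \<in> ell2 \<Longrightarrow> r\<^sup>2 * energy x \<le> energy (jacobi w x)"
    and w: "\<And>n. \<bar>w n\<bar> \<le> C" and p: "\<And>n. cmod (p n) \<le> K"
    and \<eta>: "\<eta> > 0" and sub: "\<And>n. (cmod (jacobi w p n))\<^sup>2 \<le> r\<^sup>2 * (cmod (p n))\<^sup>2 - \<eta>"
  shows False
proof -
  have K: "K \<ge> 0" using p[of 0] norm_ge_zero order_trans by blast
  have C: "C \<ge> 0" using w[of 0] abs_ge_zero order_trans by blast
  define D where "D = ((2 + C) * K)\<^sup>2 + \<eta>"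
  obtain L0 :: nat where L0: "4 * D / \<eta> < real L0" using reals_Archimedean2 by blast
  define L where "L = int L0 + 1"
  have L: "L \<ge> 1" "real_of_int L > 4 * D / \<eta>" using L0 by (auto simp: L_def)
  define x where "x = (\<lambda>n. if \<bar>n\<bar> \<le> L then p n else 0)"
  define F where "F = {- L - 1 .. L + 1}"
  define E where "E = {- L - 1, - L, L, L + 1}"
  have F: "finite F" "E \<subseteq> F" using L by (auto simp: F_def E_def)
  have x0: "x n = 0" if "n \<notin> F" for n using that by (auto simp: F_def x_def)
  have J0: "jacobi w x n = 0" if "n \<notin> F" for n
    using that by (auto simp: F_def x_def jacobi_def)
  have xK: "cmod (x n) \<le> K" for n using p[of n] K by (simp add: x_def)
  have wK: "cmod (complex_of_real (w n) * x n) \<le> C * K" for n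
    using w[of n] xK[of n] C by (auto simp: norm_mult intro!: mult_mono)
  have JK: "cmod (jacobi w x n) \<le> (2 + C) * K" for n
  proof -
    have "cmod (jacobi w x n) \<le> cmod (x (n+1)) + cmod (x (n-1)) + cmod (complex_of_real (w n) * x n)"
      unfolding jacobi_def by (intro order_trans[OF norm_triangle_ineq] add_right_mono norm_triangle_ineq)
    also have "\<dots> \<le> K + K + C * K" by (intro add_mono xK wK)
    finally show ?thesis by (simp add: algebra_simps)
  qed
  have pt: "(cmod (jacobi w x n))\<^sup>2 \<le> r\<^sup>2 * (cmod (x n))\<^sup>2 - \<eta> + (if n \<in> E then D else 0)"
    if n: "n \<in> F" for n
  proof (cases "n \<in> E")
    case True
    have "(cmod (jacobi w x n))\<^sup>2 \<le> ((2 + C) * K)\<^sup>2" by (intro power_mono JK) auto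
    moreover have "0 \<le> r\<^sup>2 * (cmod (x n))\<^sup>2" by simp
    ultimately show ?thesis using True unfolding D_def by (simp only: if_True)
  next
    case False
    then have "\<bar>n\<bar> < L" using n by (auto simp: E_def F_def)
    then have "jacobi w x n = jacobi w p n" "x n = p n" by (auto simp: jacobi_def x_def)
    then show ?thesis using sub[of n] False by simp
  qed
  have x: "x \<in> ell2" using energy_finite_support(1)[OF F(1) x0] .
  have ex: "energy x = (\<Sum>n\<in>F. (cmod (x n))\<^sup>2)" by (rule energy_finite_support(2)[OF F(1) x0])
  have "r\<^sup>2 * energy x \<le> energy (jacobi w x)" by (rule low[OF x])
  also have "\<dots> = (\<Sum>n\<in>F. (cmod (jacobi w x n))\<^sup>2)" by (rule energy_finite_support(2)[OF F(1) J0])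
  also have "\<dots> \<le> (\<Sum>n\<in>F. r\<^sup>2 * (cmod (x n))\<^sup>2 - \<eta> + (if n \<in> E then D else 0))"
    by (rule sum_mono) (rule pt)
  also have "\<dots> = r\<^sup>2 * energy x - \<eta> * card F + D * card E"
    using F by (simp add: ex sum.distrib sum_subtractf sum_distrib_left sum.If_cases Int_absorb1)
  finally have "\<eta> * card F \<le> D * card E" by simp
  also have "\<dots> \<le> D * 4"
  proof (rule mult_left_mono)
    have "card E \<le> 4" unfolding E_def by (simp add: card_insert_if)
    then show "real (card E) \<le> 4" by simp
  qed (use \<eta> in \<open>simp add: D_def\<close>)
  finally have "\<eta> * card F \<le> D * 4" .
  moreover have "real (card F) \<ge> real_of_int L" using L by (simp add: F_def)
  ultimately have "\<eta> * real_of_int L \<le> D * 4" using \<eta> by (meson mult_left_mono less_imp_le order_trans)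
  then show False using L(2) \<eta> by (simp add: field_simps)
qed

lemma wronskian_constant:
  assumes "\<And>n. jacobi w u n = 0"
  shows "Im (cnj (u n) * u (n + 1)) = Im (cnj (u 0) * u 1)"
proof -
  have step: "Im (cnj (u n) * u (n + 1)) = Im (cnj (u (n - 1)) * u n)" for n
  proof -
    have e: "u (n + 1) = - u (n - 1) - complex_of_real (w n) * u n"
      using assms[of n] unfolding jacobi_def by (simp add: algebra_simps eq_neg_iff_add_eq_0)
    show ?thesis unfolding e by (simp add: algebra_simps)
  qed
  show ?thesis
  proof (induction n rule: int_induct[where k = 0])
    case base then show ?case by simp
  next
    case (step1 i) then show ?case using step[of "i + 1"] by simp
  next
    case (step2 i) then show ?case using step[of i] by simp
  qed
qed

text \<open>
  A bounded complex solution \<open>u\<close> with Wronskian 1 carries a current, and multiplying it by the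
  slowly rotating phase \<open>cis (\<kappa> n)\<close> changes the energy to first order in
  \<open>\<kappa>\<close>: for \<open>p = cis (\<kappa> n) u\<close> the value of \<open>(H - a) p\<close> has
  size of order \<open>\<kappa>\<close>, and its product with \<open>p\<close> at each site is \<open>- 2 sin
  \<kappa>\<close> up to order \<open>\<kappa>\<^sup>2\<close>. With the right sign of \<open>\<kappa>\<close>
  the energy of \<open>p\<close> is therefore pushed into the gap, in contradiction to the lower bound for
  \<open>H - (a + s r)\<close> at its centre. So at the edge of a gap some solution is unbounded. (In terms of
  the rotation number: it is strictly increasing at an energy with bounded solutions, whereas it is constant on
  gaps.)
\<close>

lemma bounded_solution_excludes_gap_edge:
  fixes v :: "int \<Rightarrow> real" and s :: real
  assumes v: "\<And>n. \<bar>v n\<bar> \<le> C"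
    and sol: "\<And>n. jacobi (\<lambda>n. v n - a) u n = 0" and wr: "Im (cnj (u 0) * u 1) = 1"
    and u: "\<And>n. cmod (u n) \<le> K"
    and s: "s = 1 \<or> s = -1" and r: "r > 0"
    and gap: "\<And>t. \<bar>t\<bar> < r \<Longrightarrow> complex_of_real (a + s * r + t) \<in> ell2_resolvent_set (jacobi v)"
  shows False
proof -
  define w where "w = (\<lambda>n. v n - (a + s * r))"
  have w: "\<bar>w n\<bar> \<le> C + \<bar>a + s * r\<bar>" for n using v[of n] unfolding w_def by linarith
  have low: "r\<^sup>2 * energy x \<le> energy (jacobi w x)" if "x \<in> ell2" for x
  proof (rule jacobi_lower_bound_from_gap[OF w _ r that])
    fix t :: real assume "\<bar>t\<bar> < r"
    from resolvent_bounded_below[OF gap[OF this]]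
    show "\<exists>k>0. \<forall>x\<in>ell2. k * energy x \<le> energy (jacobi (\<lambda>n. w n - t) x)"
      by (simp add: w_def algebra_simps)
  qed
  have Kpos: "K > 0"
  proof -
    have "1 \<le> cmod (cnj (u 0) * u 1)" using wr abs_Im_le_cmod[of "cnj (u 0) * u 1"] by simp
    then have "u 0 \<noteq> 0" by auto
    then have "0 < cmod (u 0)" by simp
    also have "\<dots> \<le> K" by (rule u)
    finally show ?thesis .
  qed
  \<comment> \<open>\<open>S\<close> is the sine of half the angle \<open>\<bar>\<kappa>\<bar>\<close>, so that \<open>1 - cos \<kappa> = 2 S\<^sup>2\<close>. The bound on \<open>S\<close> lets
    the first order gain \<open>4 r S\<close> beat the second order terms by a factor of two.\<close>
  define S where "S = min (1/2) (r / (8 * K\<^sup>2 + 4 * r * K\<^sup>2))"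
  have den: "8 * K\<^sup>2 + 4 * r * K\<^sup>2 > 0" using Kpos r by (intro add_pos_pos) auto
  have S: "0 < S" "S \<le> 1/2" "(8 * K\<^sup>2 + 4 * r * K\<^sup>2) * S \<le> r"
  proof -
    show "0 < S" using den r by (auto simp: S_def)
    show "S \<le> 1/2" unfolding S_def by (rule min.cobounded1)
    have "S \<le> r / (8 * K\<^sup>2 + 4 * r * K\<^sup>2)" by (simp add: S_def)
    then show "(8 * K\<^sup>2 + 4 * r * K\<^sup>2) * S \<le> r" using den by (simp add: field_simps)
  qed
  define \<kappa> where "\<kappa> = - s * (2 * arcsin S)"
  have cosk: "cos \<kappa> = 1 - 2 * S\<^sup>2"
    using s S cos_double_sin[of "arcsin S"] by (auto simp: \<kappa>_def)
  have "sin (2 * arcsin S) = 2 * S * sqrt (1 - S\<^sup>2)"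
    using S sin_double[of "arcsin S"] by (simp add: cos_arcsin)
  moreover have "sqrt (1 - S\<^sup>2) \<ge> 1/2"
  proof (rule real_le_rsqrt)
    have "S\<^sup>2 \<le> (1/2)\<^sup>2" using S by (intro power_mono) auto
    then show "(1/2)\<^sup>2 \<le> 1 - S\<^sup>2" by (simp add: power2_eq_square)
  qed
  ultimately have "sin (2 * arcsin S) \<ge> S"
    using S(1) mult_left_mono[of "1/2" "sqrt (1 - S\<^sup>2)" "2 * S"] by simp
  then have sink: "- s * sin \<kappa> \<ge> S" using s by (auto simp: \<kappa>_def)
  have nk: "(cmod (cis \<kappa> - 1))\<^sup>2 = 4 * S\<^sup>2"
  proof -
    have "(cmod (cis \<kappa> - 1))\<^sup>2 = (cos \<kappa> - 1)\<^sup>2 + (sin \<kappa>)\<^sup>2"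
      unfolding cmod_power2 by simp
    also have "\<dots> = 2 - 2 * cos \<kappa>"
      using sin_cos_squared_add[of \<kappa>] by (simp add: power2_diff)
    finally show ?thesis by (simp add: cosk)
  qed
  define p where "p = (\<lambda>n. cis (\<kappa> * of_int n) * u n)"
  \<comment> \<open>\<open>d\<close> is the value of \<open>(H - a) p\<close> with the phase removed.\<close>
  define d where "d = (\<lambda>n. (cis \<kappa> - 1) * u (n + 1) + (cis (- \<kappa>) - 1) * u (n - 1))"
  have Jp: "jacobi w p n = cis (\<kappa> * of_int n) * (d n - of_real (s * r) * u n)" for n
  proof -
    have e: "u (n + 1) + u (n - 1) + complex_of_real (v n - a) * u n = 0"
      using sol[of n] by (simp add: jacobi_def)
    have "cis (\<kappa> * of_int (n + 1)) = cis (\<kappa> * of_int n) * cis \<kappa>"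
         "cis (\<kappa> * of_int (n - 1)) = cis (\<kappa> * of_int n) * cis (-\<kappa>)"
      by (simp_all add: cis_mult algebra_simps)
    then have "jacobi w p n = cis (\<kappa> * of_int n) * (cis \<kappa> * u (n + 1) + cis (-\<kappa>) * u (n - 1) + of_real (w n) * u n)"
      unfolding jacobi_def p_def by (simp add: algebra_simps)
    also have "cis \<kappa> * u (n + 1) + cis (-\<kappa>) * u (n - 1) + of_real (w n) * u n
       = d n - of_real (s * r) * u n + (u (n + 1) + u (n - 1) + complex_of_real (v n - a) * u n)"
      unfolding d_def w_def by (simp add: algebra_simps)
    finally show ?thesis using e by simp
  qed
  define z where "z = (\<lambda>n. cnj (u n) * u (n + 1))"
  have Imz: "Im (z n) = 1" for n using wronskian_constant[OF sol] wr by (simp add: z_def)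
  have Rez: "\<bar>Re (z n)\<bar> \<le> K\<^sup>2" for n
  proof -
    have "\<bar>Re (z n)\<bar> \<le> cmod (z n)" by (rule abs_Re_le_cmod)
    also have "\<dots> \<le> K * K" unfolding z_def norm_mult using u Kpos by (intro mult_mono) auto
    finally show ?thesis by (simp add: power2_eq_square)
  qed
  have du: "s * (d n \<bullet> u n) \<ge> 2 * S - 4 * K\<^sup>2 * S\<^sup>2" for n
  proof -
    have "d n \<bullet> u n = (Re (z n) + Re (z (n - 1))) * (cos \<kappa> - 1) - (Im (z n) + Im (z (n - 1))) * sin \<kappa>"
      unfolding d_def z_def inner_complex_def by (simp add: algebra_simps)
    then have e: "d n \<bullet> u n = (Re (z n) + Re (z (n - 1))) * (- 2 * S\<^sup>2) - 2 * sin \<kappa>"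
      unfolding Imz cosk by simp
    have "s * (d n \<bullet> u n) = - 2 * S\<^sup>2 * (s * (Re (z n) + Re (z (n - 1)))) + 2 * (- s * sin \<kappa>)"
      unfolding e by (simp add: algebra_simps)
    moreover have "s * (Re (z n) + Re (z (n - 1))) \<le> 2 * K\<^sup>2"
      using Rez[of n] Rez[of "n - 1"] s by auto
    then have "- 2 * S\<^sup>2 * (s * (Re (z n) + Re (z (n - 1)))) \<ge> - 2 * S\<^sup>2 * (2 * K\<^sup>2)"
      by (intro mult_left_mono_neg) auto
    ultimately show ?thesis using sink by (simp add: algebra_simps)
  qed
  have dn: "(cmod (d n))\<^sup>2 \<le> 16 * K\<^sup>2 * S\<^sup>2" for n
  proof -
    have c: "cmod (cis (-\<kappa>) - 1) = cmod (cis \<kappa> - 1)"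
      using complex_mod_cnj[of "cis \<kappa> - 1"] by (simp add: cis_cnj)
    have "cmod (d n) \<le> cmod ((cis \<kappa> - 1) * u (n + 1)) + cmod ((cis (- \<kappa>) - 1) * u (n - 1))"
      unfolding d_def by (rule norm_triangle_ineq)
    also have "\<dots> \<le> cmod (cis \<kappa> - 1) * K + cmod (cis \<kappa> - 1) * K"
      unfolding norm_mult c by (intro add_mono mult_left_mono u norm_ge_zero)
    also have "\<dots> = 2 * K * cmod (cis \<kappa> - 1)" by simp
    finally have "(cmod (d n))\<^sup>2 \<le> (2 * K * cmod (cis \<kappa> - 1))\<^sup>2"
      by (intro power_mono) auto
    then show ?thesis by (simp add: power_mult_distrib nk)
  qed
  have "(cmod (jacobi w p n))\<^sup>2 \<le> r\<^sup>2 * (cmod (p n))\<^sup>2 - 2 * r * S" for n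
  proof -
    have "(cmod (jacobi w p n))\<^sup>2 = (cmod (d n - of_real (s * r) * u n))\<^sup>2"
      unfolding Jp by (simp add: norm_mult)
    also have "\<dots> = (cmod (d n))\<^sup>2 - 2 * r * (s * (d n \<bullet> u n)) + (s * r)\<^sup>2 * (cmod (u n))\<^sup>2"
      unfolding cmod_power2 inner_complex_def by (simp add: algebra_simps power2_eq_square)
    also have "(s * r)\<^sup>2 = r\<^sup>2" using s by auto
    also have "(cmod (d n))\<^sup>2 - 2 * r * (s * (d n \<bullet> u n)) + r\<^sup>2 * (cmod (u n))\<^sup>2
       \<le> 16 * K\<^sup>2 * S\<^sup>2 - 2 * r * (2 * S - 4 * K\<^sup>2 * S\<^sup>2) + r\<^sup>2 * (cmod (u n))\<^sup>2"
      using r by (intro add_right_mono diff_mono dn mult_left_mono du) auto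
    also have "\<dots> = r\<^sup>2 * (cmod (u n))\<^sup>2 - 4 * r * S + 2 * S * ((8 * K\<^sup>2 + 4 * r * K\<^sup>2) * S)"
      by (simp add: algebra_simps power2_eq_square)
    also have "\<dots> \<le> r\<^sup>2 * (cmod (u n))\<^sup>2 - 4 * r * S + 2 * S * r"
      using S by (intro add_left_mono mult_left_mono) auto
    also have "cmod (u n) = cmod (p n)" by (simp add: p_def norm_mult)
    finally show ?thesis by (simp add: algebra_simps)
  qed
  moreover have "cmod (p n) \<le> K" for n using u by (simp add: p_def norm_mult)
  moreover have "2 * r * S > 0" using r S by simp
  ultimately show False using lower_bound_excludes_subsolution[OF low w] by blast
qed

section \<open>Countability of the eigenvalues of a symmetric operator on the circle\<close>

text \<open>
  Each member has a nonzero integral over some interval with rational endpoints. For a fixed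
  interval and a fixed lower bound on the normalized integrals, Bessel's inequality leaves
  finitely many members.
\<close>

lemma orthogonal_family_countable:
  fixes f :: "'i \<Rightarrow> real \<Rightarrow> real"
  assumes cont: "\<And>i. i \<in> I \<Longrightarrow> continuous_on {a..b} (f i)"
    and orth: "\<And>i j. i \<in> I \<Longrightarrow> j \<in> I \<Longrightarrow> i \<noteq> j \<Longrightarrow> integral {a..b} (\<lambda>t. f i t * f j t) = 0"
    and nz: "\<And>i. i \<in> I \<Longrightarrow> \<exists>t\<in>{a<..<b}. f i t \<noteq> 0"
  shows "countable I"
proof -
  define N where "N = (\<lambda>i. integral {a..b} (\<lambda>t. (f i t)\<^sup>2))"
  define J where "J = (\<lambda>p q i. integral {real_of_rat p..real_of_rat q} (f i))"
  define A where "A = (\<lambda>p q n. {i\<in>I. N i > 0 \<and> (J p q i)\<^sup>2 \<ge> N i / real (Suc n)})"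
  define Q where "Q = {(p, q). real_of_rat p < real_of_rat q \<and> {real_of_rat p..real_of_rat q} \<subseteq> {a..b}}"
  have sub: "continuous_on {real_of_rat p..real_of_rat q} (f i)" if "(p, q) \<in> Q" "i \<in> I" for p q i
    using cont[OF that(2)] that(1) unfolding Q_def by (auto intro: continuous_on_subset)
  have bessel: "(\<Sum>i\<in>F. (J p q i)\<^sup>2 / N i) \<le> real_of_rat q - real_of_rat p"
    if pq: "(p, q) \<in> Q" and F: "finite F" "F \<subseteq> I" "\<And>i. i \<in> F \<Longrightarrow> N i > 0" for p q F
  proof -
    \<comment> \<open>\<open>h\<close> is the projection of the indicator function of \<open>[p, q]\<close> to the span of the family;
      both \<open>\<integral> h\<close> over \<open>[p, q]\<close> and \<open>\<integral> h\<^sup>2\<close> equal the Bessel sum.\<close>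
    define c where "c = (\<lambda>i. J p q i / N i)"
    define h where "h = (\<lambda>t. \<Sum>i\<in>F. c i * f i t)"
    let ?s = "\<Sum>i\<in>F. (J p q i)\<^sup>2 / N i"
    have hc: "continuous_on {a..b} h" unfolding h_def using cont F by (intro continuous_intros) auto
    have sub': "{real_of_rat p..real_of_rat q} \<subseteq> {a..b}" using pq by (auto simp: Q_def)
    have hc': "continuous_on {real_of_rat p..real_of_rat q} h" using hc sub' continuous_on_subset by blast
    have "integral {real_of_rat p..real_of_rat q} h = (\<Sum>i\<in>F. integral {real_of_rat p..real_of_rat q} (\<lambda>t. c i * f i t))"
      unfolding h_def using F sub[OF pq]
      by (intro integral_sum integrable_continuous_real continuous_intros) auto
    also have "\<dots> = ?s"
      by (intro sum.cong refl) (simp add: c_def J_def power2_eq_square)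
    finally have h1: "integral {real_of_rat p..real_of_rat q} h = ?s" .
    have "integral {a..b} (\<lambda>t. (h t)\<^sup>2) = integral {a..b} (\<lambda>t. \<Sum>i\<in>F. \<Sum>j\<in>F. (c i * c j) * (f i t * f j t))"
      unfolding h_def power2_eq_square sum_product by (simp add: mult_ac)
    also have "\<dots> = (\<Sum>i\<in>F. \<Sum>j\<in>F. (c i * c j) * integral {a..b} (\<lambda>t. f i t * f j t))"
    proof (subst integral_sum)
      have int: "(\<lambda>t. (c i * c j) * (f i t * f j t)) integrable_on {a..b}" if "i \<in> F" "j \<in> F" for i j
        using that F cont by (intro integrable_continuous_real continuous_intros) auto
      show "(\<lambda>t. \<Sum>j\<in>F. (c i * c j) * (f i t * f j t)) integrable_on {a..b}" if "i \<in> F" for i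
        using int that F by (intro integrable_sum) auto
      show "(\<Sum>i\<in>F. integral {a..b} (\<lambda>t. \<Sum>j\<in>F. c i * c j * (f i t * f j t)))
          = (\<Sum>i\<in>F. \<Sum>j\<in>F. (c i * c j) * integral {a..b} (\<lambda>t. f i t * f j t))"
        using int F by (intro sum.cong refl, subst integral_sum) auto
    qed (rule F)
    also have "\<dots> = (\<Sum>i\<in>F. \<Sum>j\<in>F. if j = i then (c i)\<^sup>2 * N i else 0)"
      using F orth unfolding N_def by (intro sum.cong refl) (auto simp: power2_eq_square subset_iff)
    also have "\<dots> = (\<Sum>i\<in>F. (c i)\<^sup>2 * N i)" using F by simp
    also have "\<dots> = ?s"
    proof (intro sum.cong refl)
      fix i assume "i \<in> F" then have "N i > 0" by (rule F(3))
      then show "(c i)\<^sup>2 * N i = (J p q i)\<^sup>2 / N i" by (simp add: c_def power2_eq_square field_simps)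
    qed
    finally have h2: "integral {a..b} (\<lambda>t. (h t)\<^sup>2) = ?s" .
    have "2 * ?s = integral {real_of_rat p..real_of_rat q} (\<lambda>t. 2 * h t)" by (simp add: h1)
    also have "\<dots> \<le> integral {real_of_rat p..real_of_rat q} (\<lambda>t. 1 + (h t)\<^sup>2)"
    proof (intro integral_le integrable_continuous_real continuous_intros hc')
      fix t show "2 * h t \<le> 1 + (h t)\<^sup>2" using sum_squares_bound[of "h t" 1] by simp
    qed
    also have "\<dots> = (real_of_rat q - real_of_rat p) + integral {real_of_rat p..real_of_rat q} (\<lambda>t. (h t)\<^sup>2)"
      using pq by (subst integral_add) (auto simp: Q_def intro!: integrable_continuous_real continuous_intros hc')
    also have "\<dots> \<le> (real_of_rat q - real_of_rat p) + integral {a..b} (\<lambda>t. (h t)\<^sup>2)"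
      by (intro add_left_mono integral_subset_le sub' integrable_continuous_real continuous_intros hc hc') auto
    finally show ?thesis unfolding h2 by simp
  qed
  have finA: "finite (A p q n)" if pq: "(p, q) \<in> Q" for p q n
  proof (rule ccontr)
    assume "infinite (A p q n)"
    define l where "l = real_of_rat q - real_of_rat p"
    obtain m :: nat where m: "real (Suc n) * l < real m" using reals_Archimedean2 by blast
    obtain F where F: "F \<subseteq> A p q n" "finite F" "card F = m"
      using infinite_arbitrarily_large[OF \<open>infinite (A p q n)\<close>] by blast
    have "real m * (1 / real (Suc n)) = (\<Sum>i\<in>F. 1 / real (Suc n))" using F by simp
    also have "\<dots> \<le> (\<Sum>i\<in>F. (J p q i)\<^sup>2 / N i)"
    proof (rule sum_mono)
      fix i assume "i \<in> F"
      then have "N i > 0" "(J p q i)\<^sup>2 \<ge> N i / real (Suc n)" using F unfolding A_def by auto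
      then show "1 / real (Suc n) \<le> (J p q i)\<^sup>2 / N i" by (simp add: field_simps del: of_nat_Suc)
    qed
    also have "\<dots> \<le> l" unfolding l_def using F by (intro bessel[OF pq]) (auto simp: A_def)
    finally show False using m by (simp add: field_simps del: of_nat_Suc)
  qed
  have "I \<subseteq> (\<Union>(p, q)\<in>Q. \<Union>n. A p q n)"
  proof
    fix i assume i: "i \<in> I"
    obtain t where t: "t \<in> {a<..<b}" "f i t \<noteq> 0" using nz[OF i] by blast
    define g where "g = (\<lambda>x. sgn (f i t) * f i x)"
    have gt: "g t > 0" using t(2) by (simp add: g_def sgn_if)
    have gc: "continuous_on {a<..<b} g" unfolding g_def
      by (intro continuous_intros continuous_on_subset[OF cont[OF i]]) auto
    have "open (g -` {0<..} \<inter> {a<..<b})"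
      using continuous_open_preimage[OF gc, of "{0<..}"] by (simp add: Int_commute)
    then obtain e where e: "e > 0" "ball t e \<subseteq> g -` {0<..} \<inter> {a<..<b}"
      using t(1) gt open_contains_ball by (metis IntI greaterThan_iff vimageI2)
    obtain p where p: "t - e < real_of_rat p" "real_of_rat p < t" using of_rat_dense[of "t - e" t] e by auto
    obtain q where q: "t < real_of_rat q" "real_of_rat q < t + e" using of_rat_dense[of t "t + e"] e by auto
    have I: "{real_of_rat p..real_of_rat q} \<subseteq> ball t e" using p q by (auto simp: dist_real_def)
    have pq: "(p, q) \<in> Q" using I e p q unfolding Q_def by (auto simp: less_imp_le subset_iff)
    have cpq: "continuous_on {real_of_rat p..real_of_rat q} g"
      unfolding g_def by (intro continuous_intros sub[OF pq i])
    have gnn: "g x \<ge> 0" if "x \<in> {real_of_rat p..real_of_rat q}" for x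
    proof -
      have "x \<in> g -` {0<..}" using that I e(2) by blast
      then show ?thesis by simp
    qed
    have lt: "real_of_rat p < real_of_rat q" using p q by linarith
    have "integral {real_of_rat p..real_of_rat q} g \<noteq> 0"
    proof
      assume "integral {real_of_rat p..real_of_rat q} g = 0"
      then have "\<forall>x\<in>{real_of_rat p..real_of_rat q}. g x = 0"
        using integral_eq_0_iff[OF cpq lt gnn] by blast
      then show False using gt p q by auto
    qed
    moreover have "integral {real_of_rat p..real_of_rat q} g = sgn (f i t) * J p q i"
      unfolding g_def J_def by simp
    ultimately have J: "J p q i \<noteq> 0" by auto
    have Nnn: "N i \<ge> 0" unfolding N_def by (intro integral_nonneg integrable_continuous_real continuous_intros cont i) auto
    have ab: "a < b" using t by auto
    have "N i \<noteq> 0"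
    proof
      assume "N i = 0"
      then have "\<forall>x\<in>{a..b}. (f i x)\<^sup>2 = 0"
        using integral_eq_0_iff[of a b "\<lambda>x. (f i x)\<^sup>2"] cont[OF i] ab unfolding N_def
        by (auto intro!: continuous_intros)
      then show False using t by auto
    qed
    then have N: "N i > 0" using Nnn by simp
    obtain n :: nat where "N i / (J p q i)\<^sup>2 < real n" using reals_Archimedean2 by blast
    then have "N i / (J p q i)\<^sup>2 < real (Suc n)" by simp
    then have "i \<in> A p q n" using i N J by (simp add: A_def field_simps del: of_nat_Suc)
    then show "i \<in> (\<Union>(p, q)\<in>Q. \<Union>n. A p q n)" using pq by auto
  qed
  moreover have "countable (\<Union>(p, q)\<in>Q. \<Union>n. A p q n)"
  proof (rule countable_UN)
    fix x assume x: "x \<in> Q"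
    obtain p q where pq: "x = (p, q)" by (cases x)
    have "countable (\<Union>n. A p q n)"
      by (rule countable_UN) (use finA x pq in \<open>simp_all add: countable_finite\<close>)
    then show "countable (case x of (p, q) \<Rightarrow> \<Union>n. A p q n)" by (simp add: pq)
  qed (rule countableI_type)
  ultimately show ?thesis using countable_subset by blast
qed

lemma integral_circle_shift:
  fixes h :: "real \<Rightarrow> real"
  assumes per: "circle_fun h" and cont: "continuous_on UNIV h"
  shows "integral {0..2*pi} (\<lambda>t. h (t + c)) = integral {0..2*pi} h"
proof -
  have pos: "integral {0..2*pi} (\<lambda>t. g (t + c)) = integral {0..2*pi} g"
    if g: "circle_fun g" "continuous_on UNIV g" and c: "c \<ge> 0" for g :: "real \<Rightarrow> real" and c
  proof -
    have int: "g integrable_on {x..y}" for x y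
      by (intro integrable_continuous_real continuous_on_subset[OF g(2)]) auto
    have "integral {0..2*pi} (\<lambda>t. g (t + c)) = integral {c..2*pi + c} g"
      using integral_shift_real_ivl[of c c "2*pi + c" g] by simp
    moreover have "integral {0..c} g + integral {c..2*pi + c} g = integral {0..2*pi + c} g"
      using c by (intro Henstock_Kurzweil_Integration.integral_combine int) auto
    moreover have "integral {0..2*pi} g + integral {2*pi..2*pi + c} g = integral {0..2*pi + c} g"
      using c by (intro Henstock_Kurzweil_Integration.integral_combine int) auto
    moreover have "integral {2*pi..2*pi + c} g = integral {0..c} g"
      using integral_shift_real_ivl[of "2*pi" "2*pi" "2*pi + c" g] g(1) by (simp add: circle_fun_def)
    ultimately show ?thesis by linarith
  qed
  show ?thesis
  proof (cases "c \<ge> 0")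
    case True then show ?thesis using pos[OF per cont] by simp
  next
    case False
    have "circle_fun (\<lambda>t. h (t + c))"
      using per by (simp add: circle_fun_def algebra_simps) (metis add.commute add.assoc)
    moreover have "continuous_on UNIV (\<lambda>t. h (t + c))"
      by (intro continuous_on_compose2[OF cont] continuous_intros) auto
    ultimately show ?thesis using pos[of "\<lambda>t. h (t + c)" "- c"] False by simp
  qed
qed

lemma circle_fun_representative:
  assumes "circle_fun f"
  shows "\<exists>t'\<in>{0..2*pi}. f t' = f t"
proof -
  have shift: "f (t + 2 * pi * of_int k) = f t" for t k
  proof (induction k arbitrary: t rule: int_induct[where k = 0])
    case base then show ?case by simp
  next
    case (step1 i)
    have "f (t + 2 * pi * of_int (i + 1)) = f ((t + 2 * pi * of_int i) + 2 * pi)"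
      by (simp add: algebra_simps)
    then show ?case using step1 assms by (simp add: circle_fun_def)
  next
    case (step2 i)
    have "f (t + 2 * pi * of_int i) = f ((t + 2 * pi * of_int (i - 1)) + 2 * pi)"
      by (simp add: algebra_simps)
    then show ?case using step2 assms by (simp add: circle_fun_def)
  qed
  define k where "k = \<lfloor>t / (2 * pi)\<rfloor>"
  have "of_int k \<le> t / (2 * pi)" "t / (2 * pi) < of_int k + 1" unfolding k_def by linarith+
  then have "t - 2 * pi * of_int k \<in> {0..2*pi}" by (auto simp: field_simps)
  moreover have "f (t - 2 * pi * of_int k) = f t" using shift[of "t - 2 * pi * of_int k" k] by simp
  ultimately show ?thesis by blast
qed

text \<open>
  For \<open>s = 1\<close> these are the continuous eigenfunctions of the operator on the circle that acts like
  the Schroedinger operator along each orbit of the rotation by \<open>\<alpha>\<close>, the Fourier transform of the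
  Aubry dual. A cocycle conjugate to a matrix of trace 2 or -2 yields such a function with
  \<open>s = 1\<close> or \<open>s = - 1\<close>.
\<close>

definition twisted_eigenfunction ::
    "real \<Rightarrow> real \<Rightarrow> (real \<Rightarrow> real) \<Rightarrow> real \<Rightarrow> (real \<Rightarrow> real) \<Rightarrow> bool" where
  "twisted_eigenfunction s \<alpha> V a f \<longleftrightarrow>
     circle_fun f \<and> continuous_on UNIV f \<and> (\<exists>\<theta>. f \<theta> \<noteq> 0) \<and>
     (\<forall>\<theta>. s * (f (\<theta> + \<alpha>) + f (\<theta> - \<alpha>)) + V \<theta> * f \<theta> = a * f \<theta>)"

lemma circle_fun_mult:
  fixes f g :: "real \<Rightarrow> real"
  shows "circle_fun f \<Longrightarrow> circle_fun g \<Longrightarrow> circle_fun (\<lambda>t. f t * g t)"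
  by (simp add: circle_fun_def)

lemma circle_fun_shift: "circle_fun f \<Longrightarrow> circle_fun (\<lambda>t. f (t + c))"
  unfolding circle_fun_def by (metis add.assoc add.commute)

text \<open>
  The operator is symmetric, since translations preserve the integral over the circle.
\<close>

lemma twisted_eigenfunctions_orthogonal:
  assumes f: "twisted_eigenfunction s \<alpha> V a f" and g: "twisted_eigenfunction s \<alpha> V b g"
    and ab: "a \<noteq> b"
  shows "integral {0..2*pi} (\<lambda>t. f t * g t) = 0"
proof -
  have fp: "circle_fun f" and gp: "circle_fun g" and fc: "continuous_on UNIV f" and gc: "continuous_on UNIV g"
    and fe: "\<And>t. s * (f (t + \<alpha>) + f (t - \<alpha>)) + V t * f t = a * f t"
    and ge: "\<And>t. s * (g (t + \<alpha>) + g (t - \<alpha>)) + V t * g t = b * g t"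
    using f g by (auto simp: twisted_eigenfunction_def)
  have swap: "integral {0..2*pi} (\<lambda>t. p (t + \<alpha>) * q t) = integral {0..2*pi} (\<lambda>t. p t * q (t - \<alpha>))"
    if pq: "circle_fun p" "circle_fun q" "continuous_on UNIV p" "continuous_on UNIV q" for p q :: "real \<Rightarrow> real"
  proof -
    have "circle_fun (\<lambda>t. p t * q (t - \<alpha>))"
      using circle_fun_mult[OF pq(1) circle_fun_shift[OF pq(2), of "- \<alpha>"]] by simp
    moreover have "continuous_on UNIV (\<lambda>t. p t * q (t - \<alpha>))"
      by (intro continuous_intros pq continuous_on_compose2[OF pq(4)]) auto
    ultimately show ?thesis using integral_circle_shift[of "\<lambda>t. p t * q (t - \<alpha>)" \<alpha>] by simp
  qed
  have int: "(\<lambda>t. p (t + c) * q (t + d)) integrable_on {0..2*pi}"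
    if "continuous_on UNIV p" "continuous_on UNIV q" for p q :: "real \<Rightarrow> real" and c d
    by (intro integrable_continuous_real continuous_intros continuous_on_compose2[OF that(1)]
        continuous_on_compose2[OF that(2)]) auto
  have i1: "(\<lambda>t. f (t + \<alpha>) * g t) integrable_on {0..2*pi}" using int[OF fc gc, of \<alpha> 0] by simp
  have i2: "(\<lambda>t. f t * g (t - \<alpha>)) integrable_on {0..2*pi}" using int[OF fc gc, of 0 "-\<alpha>"] by simp
  have i3: "(\<lambda>t. g (t + \<alpha>) * f t) integrable_on {0..2*pi}" using int[OF gc fc, of \<alpha> 0] by simp
  have i4: "(\<lambda>t. g t * f (t - \<alpha>)) integrable_on {0..2*pi}" using int[OF gc fc, of 0 "-\<alpha>"] by simp
  let ?d = "\<lambda>t. s * ((f (t + \<alpha>) * g t - f t * g (t - \<alpha>)) - (g (t + \<alpha>) * f t - g t * f (t - \<alpha>)))"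
  have pt: "(a - b) * (f t * g t) = ?d t" for t
  proof -
    have "(a - b) * (f t * g t) = (a * f t) * g t - f t * (b * g t)" by (simp add: algebra_simps)
    also have "\<dots> = ?d t" unfolding fe[symmetric] ge[symmetric] by (simp add: algebra_simps)
    finally show ?thesis .
  qed
  have "(a - b) * integral {0..2*pi} (\<lambda>t. f t * g t) = integral {0..2*pi} ?d"
    unfolding pt[symmetric] by simp
  also have "\<dots> = s * integral {0..2*pi} (\<lambda>t. (f (t + \<alpha>) * g t - f t * g (t - \<alpha>)) - (g (t + \<alpha>) * f t - g t * f (t - \<alpha>)))"
    by simp
  also have "\<dots> = s * ((integral {0..2*pi} (\<lambda>t. f (t + \<alpha>) * g t) - integral {0..2*pi} (\<lambda>t. f t * g (t - \<alpha>)))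
     - (integral {0..2*pi} (\<lambda>t. g (t + \<alpha>) * f t) - integral {0..2*pi} (\<lambda>t. g t * f (t - \<alpha>))))"
    by (simp add: Henstock_Kurzweil_Integration.integral_diff i1 i2 i3 i4 integrable_diff)
  also have "\<dots> = 0" unfolding swap[OF fp gp fc gc] swap[OF gp fp gc fc] by simp
  finally show ?thesis using ab by simp
qed

lemma countable_twisted_eigenvalues: "countable {a. \<exists>f. twisted_eigenfunction s \<alpha> V a f}"
proof -
  define I where "I = {a. \<exists>f. twisted_eigenfunction s \<alpha> V a f}"
  define F where "F = (\<lambda>a. SOME f. twisted_eigenfunction s \<alpha> V a f)"
  have F: "twisted_eigenfunction s \<alpha> V a (F a)" if "a \<in> I" for a
    using that by (simp add: I_def F_def someI_ex)
  have "countable I"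
  proof (rule orthogonal_family_countable)
    fix a assume a: "a \<in> I"
    show "continuous_on {0..2*pi} (F a)"
      using F[OF a] continuous_on_subset unfolding twisted_eigenfunction_def by blast
    show "\<exists>t\<in>{0<..<2*pi}. F a t \<noteq> 0"
    proof (rule ccontr)
      assume "\<not> ?thesis"
      then have z: "F a t = 0" if "t \<in> {0<..<2*pi}" for t using that by blast
      have cF: "continuous_on UNIV (F a)" and pF: "circle_fun (F a)"
        using F[OF a] by (auto simp: twisted_eigenfunction_def)
      have z': "F a t = 0" if "t \<in> closure {0<..<2*pi}" for t
        by (rule continuous_constant_on_closure[OF continuous_on_subset[OF cF] _ that]) (use z in auto)
      have zz: "F a t = 0" if "t \<in> {0..2*pi}" for t using z' that by simp
      have "F a t = 0" for t using circle_fun_representative[OF pF] zz by metis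
      then show False using F[OF a] by (auto simp: twisted_eigenfunction_def)
    qed
    fix b assume b: "b \<in> I" and ab: "a \<noteq> b"
    show "integral {0..2*pi} (\<lambda>t. F a t * F b t) = 0"
      by (rule twisted_eigenfunctions_orthogonal[OF F[OF a] F[OF b] ab])
  qed
  then show ?thesis by (simp add: I_def)
qed

section \<open>Exponential dichotomy and the resolvent set\<close>

lemma cmod_sq_le_energy:
  assumes "x \<in> ell2"
  shows "(cmod (x n))\<^sup>2 \<le> energy x"
proof -
  have "(\<Sum>m\<in>{n}. (cmod (x m))\<^sup>2) \<le> energy x"
    unfolding energy_eq using assms by (intro finite_sum_le_infsum) (auto simp: ell2_def)
  then show ?thesis by simp
qed

text \<open>
  Convexity of the square, with weights \<open>cmod \<mu>\<close> and \<open>1 - cmod \<mu>\<close>. Summed over \<open>n\<close>, this controls a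
  contracting recursion in the square norm.
\<close>

lemma contraction_step:
  fixes \<mu> q g :: complex
  assumes "cmod \<mu> < 1"
  shows "(cmod (\<mu> * q + g))\<^sup>2 \<le> cmod \<mu> * (cmod q)\<^sup>2 + (cmod g)\<^sup>2 / (1 - cmod \<mu>)"
proof -
  define m where "m = cmod \<mu>"
  define b where "b = cmod q"
  define c where "c = cmod g"
  have m: "0 \<le> m" "m < 1" using assms by (auto simp: m_def)
  have "cmod (\<mu> * q + g) \<le> m * b + c"
    unfolding m_def b_def c_def norm_mult[symmetric] by (rule norm_triangle_ineq)
  then have "(cmod (\<mu> * q + g))\<^sup>2 \<le> (m * b + c)\<^sup>2" by (intro power_mono) auto
  also have "\<dots> \<le> m * b\<^sup>2 + c\<^sup>2 / (1 - m)"
  proof -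
    have "0 \<le> m * ((1 - m) * b - c)\<^sup>2" using m by simp
    also have "\<dots> = (1 - m) * (m * b\<^sup>2) + c\<^sup>2 - (1 - m) * (m * b + c)\<^sup>2"
      by (simp add: power2_eq_square algebra_simps)
    finally have "(1 - m) * (m * b + c)\<^sup>2 \<le> (1 - m) * (m * b\<^sup>2) + c\<^sup>2" by simp
    then have "(m * b + c)\<^sup>2 \<le> ((1 - m) * (m * b\<^sup>2) + c\<^sup>2) / (1 - m)"
      using m by (simp add: pos_le_divide_eq mult.commute)
    also have "\<dots> = m * b\<^sup>2 + c\<^sup>2 / (1 - m)" using m by (simp add: add_divide_distrib)
    finally show ?thesis .
  qed
  finally show ?thesis by (simp add: m_def b_def c_def)
qed

lemma contraction_energy:
  assumes \<mu>: "cmod \<mu> < 1" and q: "q \<in> ell2" and g: "g \<in> ell2"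
    and rec: "\<And>n. q (n + 1) = \<mu> * q n + g n"
  shows "energy q \<le> energy g / (1 - cmod \<mu>)\<^sup>2"
proof -
  have sq: "(\<lambda>n. (cmod (q n))\<^sup>2) summable_on UNIV" "(\<lambda>n. (cmod (g n))\<^sup>2) summable_on UNIV"
    using q g by (auto simp: ell2_def)
  have "energy q = energy (\<lambda>n. q (n + 1))" using energy_reindex[OF bij_shift] by simp
  also have "\<dots> \<le> (\<Sum>\<^sub>\<infinity>n. cmod \<mu> * (cmod (q n))\<^sup>2 + (cmod (g n))\<^sup>2 * (1 / (1 - cmod \<mu>)))"
    unfolding energy_eq
  proof (rule infsum_mono)
    show "(\<lambda>n. (cmod (q (n + 1)))\<^sup>2) summable_on UNIV" using ell2_shift[OF q, of 1] by (simp add: ell2_def)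
    show "(\<lambda>n. cmod \<mu> * (cmod (q n))\<^sup>2 + (cmod (g n))\<^sup>2 * (1 / (1 - cmod \<mu>))) summable_on UNIV"
      by (intro summable_on_add summable_on_cmult_right summable_on_cmult_left sq)
    fix n show "(cmod (q (n + 1)))\<^sup>2 \<le> cmod \<mu> * (cmod (q n))\<^sup>2 + (cmod (g n))\<^sup>2 * (1 / (1 - cmod \<mu>))"
      using contraction_step[OF \<mu>, of "q n" "g n"] unfolding rec by simp
  qed
  also have "\<dots> = cmod \<mu> * energy q + energy g * (1 / (1 - cmod \<mu>))"
    unfolding energy_eq
    by (subst infsum_add) (simp_all only: infsum_cmult_right infsum_cmult_left
        summable_on_cmult_right summable_on_cmult_left sq)
  finally have "(1 - cmod \<mu>) * energy q \<le> energy g / (1 - cmod \<mu>)" by (simp add: algebra_simps)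
  then have "energy q \<le> energy g / (1 - cmod \<mu>) / (1 - cmod \<mu>)"
    using \<mu> by (simp only: pos_le_divide_eq diff_gt_0_iff_gt mult.commute)
  then show ?thesis by (simp add: power2_eq_square)
qed

lemma contraction_solvable:
  assumes \<mu>: "cmod \<mu> < 1" and g: "g \<in> ell2"
  shows "\<exists>q\<in>ell2. \<forall>n. q (n + 1) = \<mu> * q n + g n"
proof -
  define m where "m = cmod \<mu>"
  have m: "0 \<le> m" "m < 1" using \<mu> by (auto simp: m_def)
  define G where "G = ell2_norm g"
  have gG: "cmod (g n) \<le> G" for n
  proof (rule power2_le_imp_le)
    show "(cmod (g n))\<^sup>2 \<le> G\<^sup>2" using cmod_sq_le_energy[OF g] by (simp add: G_def ell2_norm_sq)
    show "0 \<le> G" by (auto simp: G_def ell2_norm_def intro!: infsum_nonneg)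
  qed
  have tb: "cmod (\<mu> ^ k * g n) \<le> m ^ k * G" for k n
    unfolding norm_mult norm_power m_def by (intro mult_left_mono gG) auto
  have geo: "summable (\<lambda>k. m ^ k * G)" using m by (intro summable_mult2 summable_geometric) auto
  have sm: "summable (\<lambda>k. \<mu> ^ k * g (n - int k))" for n
    by (rule summable_comparison_test'[OF geo, of 0]) (use tb in auto)
  define q where "q = (\<lambda>n. \<Sum>k. \<mu> ^ k * g (n - 1 - int k))"
  define K where "K = (\<Sum>k. m ^ k * G)"
  have qK: "cmod (q n) \<le> K" for n
    unfolding q_def K_def by (rule norm_suminf_le[OF tb geo])
  have rec: "q (n + 1) = \<mu> * q n + g n" for n
  proof -
    have "q (n + 1) = (\<Sum>k. \<mu> ^ k * g (n - int k))" by (simp add: q_def)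
    also have "\<dots> = (\<Sum>k. \<mu> ^ Suc k * g (n - int (Suc k))) + \<mu> ^ 0 * g (n - int 0)"
      using suminf_split_head[OF sm[of n]] by simp
    also have "(\<lambda>k. \<mu> ^ Suc k * g (n - int (Suc k))) = (\<lambda>k. \<mu> * (\<mu> ^ k * g (n - 1 - int k)))"
      by (rule ext) (simp add: algebra_simps)
    also have "(\<Sum>k. \<mu> * (\<mu> ^ k * g (n - 1 - int k))) = \<mu> * q n"
      unfolding q_def by (rule suminf_mult[OF sm])
    finally show ?thesis by simp
  qed
  define b where "b = (\<lambda>n. (cmod (q n))\<^sup>2)"
  define E where "E = energy g / (1 - m)"
  have bK: "b n \<le> K\<^sup>2" for n unfolding b_def by (intro power_mono qK) auto
  \<comment> \<open>The energy estimate on a finite window: apart from the boundary term at \<open>- N\<close>, which is at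
    most \<open>K\<^sup>2\<close>, the sum is bounded by \<open>m\<close> times itself plus \<open>E\<close>.\<close>
  have window: "(\<Sum>n\<in>{-N..N}. b n) \<le> (K\<^sup>2 + E) / (1 - m)" if N: "N \<ge> 0" for N :: int
  proof -
    let ?T = "\<Sum>n\<in>{-N..N}. b n"
    have "{-N..N} = insert (-N) ((\<lambda>n. n + 1) ` {-N..N - 1})"
      using N by (auto simp: image_iff intro!: bexI[of _ "_ - 1"])
    then have "?T = b (-N) + (\<Sum>n\<in>(\<lambda>n. n + 1) ` {-N..N - 1}. b n)" by simp
    also have "(\<Sum>n\<in>(\<lambda>n. n + 1) ` {-N..N - 1}. b n) = (\<Sum>n\<in>{-N..N - 1}. b (n + 1))"
      by (subst sum.reindex) (auto simp: inj_on_def)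
    also have "\<dots> \<le> (\<Sum>n\<in>{-N..N - 1}. m * b n + (cmod (g n))\<^sup>2 / (1 - m))"
      unfolding b_def rec m_def by (intro sum_mono contraction_step[OF \<mu>])
    also have "\<dots> = m * (\<Sum>n\<in>{-N..N - 1}. b n) + (\<Sum>n\<in>{-N..N - 1}. (cmod (g n))\<^sup>2) / (1 - m)"
      by (simp add: sum.distrib sum_distrib_left sum_divide_distrib)
    also have "\<dots> \<le> m * ?T + E"
    proof (rule add_mono)
      show "m * (\<Sum>n\<in>{-N..N - 1}. b n) \<le> m * ?T"
        using m by (intro mult_left_mono sum_mono2) (auto simp: b_def)
      have "(\<Sum>n\<in>{-N..N - 1}. (cmod (g n))\<^sup>2) \<le> energy g"
        unfolding energy_eq using g by (intro finite_sum_le_infsum) (auto simp: ell2_def)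
      then show "(\<Sum>n\<in>{-N..N - 1}. (cmod (g n))\<^sup>2) / (1 - m) \<le> E"
        unfolding E_def using m by (intro divide_right_mono) auto
    qed
    finally have "(1 - m) * ?T \<le> K\<^sup>2 + E" using bK[of "-N"] by (simp add: algebra_simps)
    then show ?thesis using m by (simp add: field_simps)
  qed
  have "b summable_on UNIV"
  proof (rule nonneg_bdd_above_summable_on)
    show "bdd_above (sum b ` {F. F \<subseteq> UNIV \<and> finite F})"
    proof (rule bdd_aboveI2)
      fix F :: "int set" assume "F \<in> {F. F \<subseteq> UNIV \<and> finite F}"
      then have F: "finite F" by simp
      define N where "N = Max (insert 0 (abs ` F))"
      have "\<bar>n\<bar> \<le> N" if "n \<in> F" for n unfolding N_def using F that by (intro Max_ge) auto
      then have "F \<subseteq> {-N..N}" by (force simp: abs_le_iff)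
      moreover have "N \<ge> 0" unfolding N_def using F by (intro Max_ge) auto
      ultimately have "sum b F \<le> (\<Sum>n\<in>{-N..N}. b n)" by (intro sum_mono2) (auto simp: b_def)
      also have "\<dots> \<le> (K\<^sup>2 + E) / (1 - m)" by (rule window[OF \<open>N \<ge> 0\<close>])
      finally show "sum b F \<le> (K\<^sup>2 + E) / (1 - m)" .
    qed
  qed (simp add: b_def)
  then have "q \<in> ell2" by (simp add: ell2_def b_def)
  then show ?thesis using rec by blast
qed

text \<open>
  An expanding recursion is a contracting one run backwards: reflecting \<open>n\<close> replaces \<open>\<mu>\<close> by its
  inverse.
\<close>

lemma hyperbolic_recursion:
  assumes \<mu>: "cmod \<mu> \<noteq> 1" "\<mu> \<noteq> 0"
  shows "\<exists>C\<ge>0. \<forall>q\<in>ell2. \<forall>g\<in>ell2. (\<forall>n. q (n + 1) = \<mu> * q n + g n) \<longrightarrow> energy q \<le> C * energy g"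
    and "g \<in> ell2 \<Longrightarrow> \<exists>q\<in>ell2. \<forall>n. q (n + 1) = \<mu> * q n + g n"
proof -
  let ?r = "\<lambda>g n. - inverse \<mu> * g (- 1 - n)"
  have r_ell2: "?r g \<in> ell2" if "g \<in> ell2" for g
    by (rule ell2_mult_bounded[of _ _ "cmod (inverse \<mu>)"]) (use that ell2_reindex[OF bij_reflect[of "-1"]] in auto)
  show "\<exists>C\<ge>0. \<forall>q\<in>ell2. \<forall>g\<in>ell2. (\<forall>n. q (n + 1) = \<mu> * q n + g n) \<longrightarrow> energy q \<le> C * energy g"
  proof (cases "cmod \<mu> < 1")
    case True
    then show ?thesis using contraction_energy[OF True]
      by (intro exI[of _ "1 / (1 - cmod \<mu>)\<^sup>2"]) auto
  next
    case False
    then have "cmod \<mu> > 1" using \<mu> by simp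
    then have im: "cmod (inverse \<mu>) < 1" by (simp add: norm_inverse inverse_less_1_iff)
    let ?C = "(cmod (inverse \<mu>))\<^sup>2 / (1 - cmod (inverse \<mu>))\<^sup>2"
    show ?thesis
    proof (intro exI[of _ ?C] conjI ballI impI)
      fix q g assume q: "q \<in> ell2" and g: "g \<in> ell2" and rec: "\<forall>n. q (n + 1) = \<mu> * q n + g n"
      have rq: "(\<lambda>n. q (- n)) \<in> ell2" using q ell2_reindex[OF bij_reflect[of 0]] by simp
      have "energy q = energy (\<lambda>n. q (- n))" using energy_reindex[OF bij_reflect[of 0], of q] by simp
      also have "\<dots> \<le> energy (?r g) / (1 - cmod (inverse \<mu>))\<^sup>2"
      proof (rule contraction_energy[OF im rq r_ell2[OF g]])
        fix n
        show "q (- (n + 1)) = inverse \<mu> * q (- n) + ?r g n"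
          using rec[rule_format, of "- 1 - n"] \<mu>(2) by (simp add: field_simps)
      qed
      also have "energy (?r g) \<le> (cmod (inverse \<mu>))\<^sup>2 * energy (\<lambda>n. g (- 1 - n))"
        by (rule energy_dominated) (use g ell2_reindex[OF bij_reflect[of "-1"]] in \<open>auto simp: norm_mult\<close>)
      also have "energy (\<lambda>n. g (- 1 - n)) = energy g" by (rule energy_reindex[OF bij_reflect])
      finally show "energy q \<le> ?C * energy g" by (simp add: divide_right_mono)
    qed auto
  qed
  show "\<exists>q\<in>ell2. \<forall>n. q (n + 1) = \<mu> * q n + g n" if g: "g \<in> ell2"
  proof (cases "cmod \<mu> < 1")
    case True then show ?thesis using contraction_solvable g by blast
  next
    case False
    then have "cmod \<mu> > 1" using \<mu> by simp
    then have im: "cmod (inverse \<mu>) < 1" by (simp add: norm_inverse inverse_less_1_iff)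
    obtain q where q: "q \<in> ell2" "\<And>n. q (n + 1) = inverse \<mu> * q n + ?r g n"
      using contraction_solvable[OF im r_ell2[OF g]] by blast
    show ?thesis
    proof (intro bexI[of _ "\<lambda>n. q (- n)"] allI)
      fix n :: int
      have e: "- (n + 1) = - n - 1" by simp
      show "q (- (n + 1)) = \<mu> * q (- n) + g n"
        unfolding e using q(2)[of "- n - 1"] \<mu>(2) by (simp add: field_simps)
      show "(\<lambda>n. q (- n)) \<in> ell2" using q(1) ell2_reindex[OF bij_reflect[of 0]] by simp
    qed
  qed
qed

lemma resolvent_from_estimate:
  assumes v: "\<And>n. \<bar>v n\<bar> \<le> C"
    and est: "\<And>x. x \<in> ell2 \<Longrightarrow> energy x \<le> B * energy (jacobi (\<lambda>n. v n - a) x)"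
    and surj: "\<And>y. y \<in> ell2 \<Longrightarrow> \<exists>x\<in>ell2. jacobi (\<lambda>n. v n - a) x = y"
  shows "complex_of_real a \<in> ell2_resolvent_set (jacobi v)"
proof -
  let ?S = "jacobi (\<lambda>n. v n - a)"
  have eq: "(\<lambda>x n. jacobi v x n - complex_of_real a * x n) = ?S"
    unfolding jacobi_def by (intro ext) (simp add: algebra_simps)
  have va: "\<bar>v n - a\<bar> \<le> C + \<bar>a\<bar>" for n using v[of n] by linarith
  have inj: "inj_on ?S ell2"
  proof (rule inj_onI)
    fix x y assume x: "x \<in> ell2" and y: "y \<in> ell2" and e: "?S x = ?S y"
    define d where "d = (\<lambda>n. x n + (-1) *\<^sub>R y n)"
    have d: "d \<in> ell2" unfolding d_def by (intro ell2_add ell2_scaleR x y)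
    have "?S d n = ?S x n - ?S y n" for n by (simp add: d_def jacobi_def algebra_simps)
    then have "?S d = (\<lambda>n. 0)" using e by auto
    then have "energy d \<le> 0" using est[OF d] by (simp add: ell2_inner_def)
    then have "(cmod (d n))\<^sup>2 \<le> 0" for n using cmod_sq_le_energy[OF d] order_trans by blast
    then have "d n = 0" for n by simp
    then show "x = y" by (auto simp: d_def)
  qed
  have "?S ` ell2 = ell2"
    using jacobi_ell2[OF _ va] surj by (auto simp: image_iff) metis
  then have bij: "bij_betw ?S ell2 ell2" using inj by (simp add: bij_betw_def)
  moreover have "ell2_norm (inv_into ell2 ?S y) \<le> sqrt B * ell2_norm y" if y: "y \<in> ell2" for y
  proof -
    let ?x = "inv_into ell2 ?S y"
    have "?x \<in> ell2" "?S ?x = y"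
      using bij y by (auto simp: bij_betw_def inv_into_into f_inv_into_f)
    then have "energy ?x \<le> B * energy y" using est by metis
    then have "sqrt (energy ?x) \<le> sqrt (B * energy y)" by (rule real_sqrt_le_mono)
    then show ?thesis unfolding ell2_norm_def energy_eq[symmetric] by (simp add: real_sqrt_mult)
  qed
  ultimately show ?thesis unfolding ell2_resolvent_set_def mem_Collect_eq eq by blast
qed

text \<open>
  The sequences \<open>\<beta>\<^sup>n f1\<close> and \<open>\<beta>\<^sup>-\<^sup>n g1\<close> are solutions, one decaying in each direction. In the
  moving frame of the vectors \<open>(f1, f2)\<close> and \<open>(g1, g2)\<close> the inhomogeneous equation
  splits into two scalar recursions with multipliers \<open>\<beta>\<close> and \<open>1 / \<beta>\<close>, each of which is uniquely
  and boundedly solvable in the square summable sequences.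
\<close>

lemma floquet_pair_resolvent:
  fixes f1 f2 g1 g2 :: "int \<Rightarrow> complex" and v :: "int \<Rightarrow> real" and \<beta> D :: complex
  assumes v: "\<And>n. \<bar>v n\<bar> \<le> C"
    and \<beta>: "cmod \<beta> \<noteq> 1" "\<beta> \<noteq> 0" and D: "D \<noteq> 0"
    and f: "\<And>n. \<beta> * f1 (n + 1) = complex_of_real (a - v n) * f1 n - f2 n" "\<And>n. \<beta> * f2 (n + 1) = f1 n"
    and g: "\<And>n. g1 (n + 1) = \<beta> * (complex_of_real (a - v n) * g1 n - g2 n)" "\<And>n. g2 (n + 1) = \<beta> * g1 n"
    and det: "\<And>n. f1 n * g2 n - f2 n * g1 n = D"
    and bd: "\<And>n. cmod (f1 n) \<le> K" "\<And>n. cmod (f2 n) \<le> K" "\<And>n. cmod (g1 n) \<le> K" "\<And>n. cmod (g2 n) \<le> K"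
  shows "complex_of_real a \<in> ell2_resolvent_set (jacobi v)"
proof -
  let ?S = "jacobi (\<lambda>n. v n - a)"
  define e where "e = (\<lambda>n. complex_of_real (a - v n))"
  have S: "?S x n = x (n + 1) + x (n - 1) - e n * x n" for x n
    by (simp add: jacobi_def e_def algebra_simps)
  have va: "\<bar>v n - a\<bar> \<le> C + \<bar>a\<bar>" for n using v[of n] by linarith
  have fs: "f1 (n + 1) = inverse \<beta> * (e n * f1 n - f2 n)" "f2 (n + 1) = inverse \<beta> * f1 n" for n
    using f[of n] \<beta>(2) by (auto simp: e_def field_simps)
  have gs: "g1 (n + 1) = \<beta> * (e n * g1 n - g2 n)" "g2 (n + 1) = \<beta> * g1 n" for n
    using g[of n] by (auto simp: e_def)
  have il: "cmod (inverse \<beta>) \<noteq> 1" "inverse \<beta> \<noteq> 0" using \<beta> by (auto simp: norm_inverse)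
  \<comment> \<open>The source \<open>(y n, 0)\<close> has the coordinates \<open>cp n * y n\<close> and \<open>cq n * y n\<close> in the frame at \<open>n + 1\<close>
    (Cramer's rule, with determinant \<open>D\<close>).\<close>
  define cp where "cp = (\<lambda>n. \<beta> * g1 n / D)"
  define cq where "cq = (\<lambda>n. - inverse \<beta> * f1 n / D)"
  define P where "P = cmod \<beta> * K / cmod D"
  define Q where "Q = cmod (inverse \<beta>) * K / cmod D"
  have cp: "cmod (cp n) \<le> P" for n unfolding cp_def P_def norm_divide norm_mult
    by (intro divide_right_mono mult_left_mono bd) auto
  have cq: "cmod (cq n) \<le> Q" for n unfolding cq_def Q_def norm_divide norm_mult norm_minus_cancel
    by (intro divide_right_mono mult_left_mono bd) auto
  obtain Cp where Cp: "Cp \<ge> 0" "\<And>q g. q \<in> ell2 \<Longrightarrow> g \<in> ell2 \<Longrightarrow> (\<And>n. q (n + 1) = \<beta> * q n + g n) \<Longrightarrow> energy q \<le> Cp * energy g"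
    using hyperbolic_recursion(1)[OF \<beta>] by blast
  obtain Cq where Cq: "Cq \<ge> 0" "\<And>q g. q \<in> ell2 \<Longrightarrow> g \<in> ell2 \<Longrightarrow> (\<And>n. q (n + 1) = inverse \<beta> * q n + g n) \<Longrightarrow> energy q \<le> Cq * energy g"
    using hyperbolic_recursion(1)[OF il] by blast
  show ?thesis
  proof (rule resolvent_from_estimate[OF v])
    fix x assume x: "x \<in> ell2"
    define y where "y = ?S x"
    have y: "y \<in> ell2" unfolding y_def by (rule jacobi_ell2[OF x va])
    have xs: "x (n + 1) = e n * x n - x (n - 1) + y n" for n by (simp add: y_def S)
    have x1: "(\<lambda>n. x (n - 1)) \<in> ell2" using ell2_shift[OF x, of "-1"] by simp
    define p where "p = (\<lambda>n. (g2 n / D) * x n + (- g1 n / D) * x (n - 1))"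
    define q where "q = (\<lambda>n. (f1 n / D) * x (n - 1) + (- f2 n / D) * x n)"
    have bdD: "cmod (g2 n / D) \<le> K / cmod D" "cmod (- g1 n / D) \<le> K / cmod D"
       "cmod (f1 n / D) \<le> K / cmod D" "cmod (- f2 n / D) \<le> K / cmod D" for n
      unfolding norm_divide norm_minus_cancel by (intro divide_right_mono bd norm_ge_zero)+
    have p: "p \<in> ell2" unfolding p_def by (intro ell2_add ell2_mult_bounded[OF x bdD(1)] ell2_mult_bounded[OF x1 bdD(2)])
    have q: "q \<in> ell2" unfolding q_def by (intro ell2_add ell2_mult_bounded[OF x bdD(4)] ell2_mult_bounded[OF x1 bdD(3)])
    have prec: "p (n + 1) = \<beta> * p n + cp n * y n" for n
      unfolding p_def cp_def xs gs using D by (simp add: field_simps)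
    have qrec: "q (n + 1) = inverse \<beta> * q n + cq n * y n" for n
      unfolding q_def cq_def xs fs using D \<beta>(2) by (simp add: field_simps)
    have "f1 n * p n + g1 n * q n = x n" for n
    proof -
      have "f1 n * p n + g1 n * q n = (f1 n * g2 n - f2 n * g1 n) * x n / D"
        unfolding p_def q_def using D by (simp add: field_simps)
      then show ?thesis using D det[of n] by simp
    qed
    then have xpq: "(\<lambda>n. f1 n * p n + g1 n * q n) = x" by (rule ext)
    have "energy x = energy (\<lambda>n. f1 n * p n + g1 n * q n)" by (simp only: xpq)
    also have "\<dots> \<le> 2 * energy (\<lambda>n. f1 n * p n) + 2 * energy (\<lambda>n. g1 n * q n)"
      by (intro energy_add_le ell2_mult_bounded[OF p bd(1)] ell2_mult_bounded[OF q bd(3)])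
    also have "\<dots> \<le> 2 * (K\<^sup>2 * energy p) + 2 * (K\<^sup>2 * energy q)"
      by (intro add_mono mult_left_mono energy_mult_bounded[OF p bd(1)] energy_mult_bounded[OF q bd(3)]) auto
    also have "\<dots> \<le> 2 * (K\<^sup>2 * (Cp * (P\<^sup>2 * energy y))) + 2 * (K\<^sup>2 * (Cq * (Q\<^sup>2 * energy y)))"
    proof (intro add_mono mult_left_mono)
      have "energy p \<le> Cp * energy (\<lambda>n. cp n * y n)"
        by (rule Cp(2)[OF p ell2_mult_bounded[OF y cp] prec])
      also have "\<dots> \<le> Cp * (P\<^sup>2 * energy y)"
        by (intro mult_left_mono energy_mult_bounded[OF y cp] Cp)
      finally show "energy p \<le> Cp * (P\<^sup>2 * energy y)" .
      have "energy q \<le> Cq * energy (\<lambda>n. cq n * y n)"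
        by (rule Cq(2)[OF q ell2_mult_bounded[OF y cq] qrec])
      also have "\<dots> \<le> Cq * (Q\<^sup>2 * energy y)"
        by (intro mult_left_mono energy_mult_bounded[OF y cq] Cq)
      finally show "energy q \<le> Cq * (Q\<^sup>2 * energy y)" .
    qed auto
    finally show "energy x \<le> (2 * K\<^sup>2 * Cp * P\<^sup>2 + 2 * K\<^sup>2 * Cq * Q\<^sup>2) * energy (?S x)"
      by (simp add: y_def algebra_simps)
  next
    fix y assume y: "y \<in> ell2"
    have cpy: "(\<lambda>n. cp n * y n) \<in> ell2" and cqy: "(\<lambda>n. cq n * y n) \<in> ell2"
      by (rule ell2_mult_bounded[OF y cp], rule ell2_mult_bounded[OF y cq])
    obtain p where p: "p \<in> ell2" "\<And>n. p (n + 1) = \<beta> * p n + cp n * y n"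
      using hyperbolic_recursion(2)[OF \<beta> cpy] by blast
    obtain q where q: "q \<in> ell2" "\<And>n. q (n + 1) = inverse \<beta> * q n + cq n * y n"
      using hyperbolic_recursion(2)[OF il cqy] by blast
    define x where "x = (\<lambda>n. f1 n * p n + g1 n * q n)"
    have x: "x \<in> ell2" unfolding x_def
      by (intro ell2_add ell2_mult_bounded[OF p(1) bd(1)] ell2_mult_bounded[OF q(1) bd(3)])
    have second: "f2 (n + 1) * p (n + 1) + g2 (n + 1) * q (n + 1) = x n" for n
      unfolding p q fs gs x_def cp_def cq_def using D \<beta>(2) by (simp add: field_simps)
    have "?S x n = y n" for n
    proof -
      have "x (n + 1) = e n * x n - (f2 n * p n + g2 n * q n) + (f1 n * g2 n - f2 n * g1 n) * y n / D"
        unfolding x_def p q fs gs cp_def cq_def using D \<beta>(2) by (simp add: field_simps)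
      also have "f2 n * p n + g2 n * q n = x (n - 1)" using second[of "n - 1"] by simp
      finally show ?thesis using D det[of n] by (simp add: S)
    qed
    then show "\<exists>x\<in>ell2. ?S x = y" using x by blast
  qed
qed

section \<open>Solutions as functions of the energy\<close>

fun half_solution :: "(nat \<Rightarrow> real) \<Rightarrow> complex \<Rightarrow> complex \<Rightarrow> nat \<Rightarrow> complex" where
  "half_solution e x y 0 = x"
| "half_solution e x y (Suc 0) = y"
| "half_solution e x y (Suc (Suc k)) =
     complex_of_real (e (Suc k)) * half_solution e x y (Suc k) - half_solution e x y k"

text \<open>
  Real and imaginary part are the two standard solutions, with values \<open>(1, 0)\<close> and \<open>(0, 1)\<close> at the
  sites 0 and 1. The negative half line is generated from the sites 1, 0 by the reflected
  recursion, hence the index \<open>1 - n\<close>; both descriptions agree at these two sites.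
\<close>

definition fundamental_solution :: "(int \<Rightarrow> real) \<Rightarrow> real \<Rightarrow> int \<Rightarrow> complex" where
  "fundamental_solution v a n =
     (if n \<ge> 0 then half_solution (\<lambda>k. a - v (int k)) 1 \<i> (nat n)
      else half_solution (\<lambda>k. a - v (1 - int k)) \<i> 1 (nat (1 - n)))"

lemma fundamental_solution_forward:
  "fundamental_solution v a (int k) = half_solution (\<lambda>k. a - v (int k)) 1 \<i> k"
  by (simp add: fundamental_solution_def)

lemma fundamental_solution_backward:
  "fundamental_solution v a (1 - int k) = half_solution (\<lambda>k. a - v (1 - int k)) \<i> 1 k"
proof (cases k)
  case 0 then show ?thesis by (simp add: fundamental_solution_def)
next
  case (Suc j)
  show ?thesis
  proof (cases j)
    case 0 then show ?thesis using Suc by (simp add: fundamental_solution_def)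
  next
    case (Suc i)
    then have "\<not> 0 \<le> 1 - int k" "nat (1 - (1 - int k)) = k" using \<open>k = Suc j\<close> by auto
    then show ?thesis by (simp only: fundamental_solution_def if_False)
  qed
qed

lemma fundamental_solution_solves:
  "jacobi (\<lambda>n. v n - a) (fundamental_solution v a) n = 0"
proof (cases "n \<ge> 1")
  case True
  define k where "k = nat (n - 1)"
  have n: "n = int (Suc k)" "n - 1 = int k" "n + 1 = int (Suc (Suc k))" using True by (auto simp: k_def)
  show ?thesis
    unfolding jacobi_def n(2,3) unfolding n(1) fundamental_solution_forward half_solution.simps
    by (simp add: algebra_simps)
next
  case False
  define k where "k = nat (- n)"
  have n: "n = 1 - int (Suc k)" "n + 1 = 1 - int k" "n - 1 = 1 - int (Suc (Suc k))"
    using False by (auto simp: k_def)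
  show ?thesis
    unfolding jacobi_def n(2,3) unfolding n(1) fundamental_solution_backward half_solution.simps
    by (simp add: algebra_simps)
qed

lemma fundamental_solution_wronskian:
  "Im (cnj (fundamental_solution v a 0) * fundamental_solution v a 1) = 1"
  using fundamental_solution_forward[of v a 0] fundamental_solution_forward[of v a 1] by simp

lemma continuous_half_solution: "continuous_on UNIV (\<lambda>a. half_solution (\<lambda>k. a - w k) x y n)"
proof (induction n rule: less_induct)
  case (less n)
  consider "n = 0" | "n = Suc 0" | k where "n = Suc (Suc k)" by (metis not0_implies_Suc)
  then show ?case
    by cases (use less in \<open>auto intro!: continuous_intros\<close>)
qed

lemma continuous_fundamental_solution: "continuous_on UNIV (\<lambda>a. fundamental_solution v a n)"
  unfolding fundamental_solution_def by (cases "n \<ge> 0") (simp_all add: continuous_half_solution)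

section \<open>Reducible cocycles\<close>

lemma circle_fun_bounded:
  fixes f :: "real \<Rightarrow> 'a::metric_space"
  assumes "circle_fun f" "continuous_on UNIV f"
  shows "bounded (range f)"
proof -
  have "range f \<subseteq> f ` {0..2*pi}"
  proof
    fix y assume "y \<in> range f"
    then obtain t where "y = f t" by blast
    then show "y \<in> f ` {0..2*pi}" using circle_fun_representative[OF assms(1), of t] by (metis image_eqI)
  qed
  moreover have "compact (f ` {0..2*pi})"
    by (intro compact_continuous_image continuous_on_subset[OF assms(2)]) auto
  ultimately show ?thesis using compact_imp_bounded bounded_subset by blast
qed

lemma circle_fun_norm_bound:
  fixes f :: "real \<Rightarrow> 'a::real_normed_vector"
  assumes "circle_fun f" "continuous_on UNIV f"
  obtains K where "\<And>t. norm (f t) \<le> K"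
  using circle_fun_bounded[OF assms] unfolding bounded_iff by auto

lemma schrodinger_cocycle_mult:
  "schrodinger_cocycle a V \<theta> *v x = vector [(a - V \<theta>) * x $ 1 - x $ 2, x $ 1]"
  by (simp add: schrodinger_cocycle_def matrix_vector_mult_def vec_eq_iff forall_2 sum_2)

lemma matrix_vector_2: "(A *v x) $ i = A $ i $ 1 * x $ 1 + A $ i $ 2 * x $ 2"
  for A :: "real^2^'n" by (simp add: matrix_vector_mult_def sum_2)

text \<open>
  In the coordinates \<open>w\<close> given by the conjugacy the orbit is moved by the constant matrix \<open>B\<close>, and
  \<open>w \<mapsto> det (w, B w)\<close> is a quadratic form invariant under \<open>B\<close>. Its discriminant is
  \<open>(trace B)\<^sup>2 - 4\<close>, so for an elliptic \<open>B\<close> it is definite and confines the orbit.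
\<close>

lemma elliptic_reducible_bounded:
  fixes Z :: "real \<Rightarrow> real^2^2" and B :: "real^2^2"
  assumes B: "det B = 1" "\<bar>B$1$1 + B$2$2\<bar> < 2"
    and Z: "circle_fun Z" "continuous_on UNIV Z" "\<And>t. det (Z t) = 1"
    and conj: "\<And>t. A t ** Z t = Z (t + \<alpha>) ** B"
    and X: "\<And>n::int. X (n + 1) = A (\<alpha> * of_int n + \<phi>) *v X n"
  shows "\<exists>K. \<forall>n. \<bar>X n $ 1\<bar> \<le> K"
proof -
  define W where "W = (\<lambda>n::int. Z (\<alpha> * of_int n + \<phi>))"
  have "\<exists>Y. W n ** Y = mat 1 \<and> Y ** W n = mat 1" for n
    using Z(3) unfolding W_def by (simp add: invertible_det_nz flip: invertible_def)
  then obtain Y where Y: "\<And>n. W n ** Y n = mat 1" "\<And>n. Y n ** W n = mat 1" by metis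
  define w where "w = (\<lambda>n. Y n *v X n)"
  have Xw: "X n = W n *v w n" for n
    unfolding w_def matrix_vector_mul_assoc by (simp add: Y)
  have wB: "w (n + 1) = B *v w n" for n
  proof -
    have "W (n + 1) = Z ((\<alpha> * of_int n + \<phi>) + \<alpha>)" by (simp add: W_def algebra_simps)
    then have "W (n + 1) *v (B *v w n) = A (\<alpha> * of_int n + \<phi>) *v (W n *v w n)"
      unfolding matrix_vector_mul_assoc by (simp add: conj[symmetric] W_def)
    also have "\<dots> = X (n + 1)" using X[of n] Xw[of n] by simp
    finally have "Y (n + 1) *v (W (n + 1) *v (B *v w n)) = w (n + 1)" by (simp add: w_def)
    moreover have "Y (n + 1) *v (W (n + 1) *v (B *v w n)) = B *v w n"
      by (simp only: matrix_vector_mul_assoc[of "Y (n + 1)" "W (n + 1)"] Y matrix_vector_mul_lid)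
    ultimately show ?thesis by simp
  qed
  define p where "p = B$1$1" define q where "q = B$1$2" define r where "r = B$2$1" define s where "s = B$2$2"
  have d1: "p * s - q * r = 1" using B(1) by (simp add: det_2 p_def q_def r_def s_def)
  have comp: "w (n + 1) $ 1 = p * w n $ 1 + q * w n $ 2" "w (n + 1) $ 2 = r * w n $ 1 + s * w n $ 2" for n
    unfolding wB matrix_vector_2 p_def q_def r_def s_def by auto
  \<comment> \<open>\<open>Q n = det (w n, B (w n))\<close>.\<close>
  define Q where "Q = (\<lambda>n. r * (w n $ 1)\<^sup>2 + (s - p) * (w n $ 1 * w n $ 2) - q * (w n $ 2)\<^sup>2)"
  have Qs: "Q (n + 1) = Q n" for n
  proof -
    have "Q (n + 1) = (p * s - q * r) * Q n"
      unfolding Q_def comp by (simp add: power2_eq_square algebra_simps)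
    then show ?thesis using d1 by simp
  qed
  have Q0: "Q n = Q 0" for n
  proof (induction n rule: int_induct[where k = 0])
    case (step1 i) then show ?case using Qs[of i] by simp
  next
    case (step2 i) then show ?case using Qs[of "i - 1"] by simp
  qed simp
  define \<delta> where "\<delta> = 4 - (p + s)\<^sup>2"
  have \<delta>: "\<delta> > 0"
  proof -
    have "\<bar>p + s\<bar>\<^sup>2 < 2\<^sup>2" using B(2) by (intro power_strict_mono) (auto simp: p_def s_def)
    then show ?thesis by (simp add: \<delta>_def)
  qed
  \<comment> \<open>Completing the square in the form, once for each coordinate.\<close>
  have b2: "(w n $ 2)\<^sup>2 \<le> \<bar>4 * r * Q 0\<bar> / \<delta>" and b1: "(w n $ 1)\<^sup>2 \<le> \<bar>4 * q * Q 0\<bar> / \<delta>" for n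
  proof -
    have qr: "q * r = p * s - 1" using d1 by simp
    have "4 * r * Q n = (2 * r * w n $ 1 + (s - p) * w n $ 2)\<^sup>2 - ((s - p)\<^sup>2 + 4 * (q * r)) * (w n $ 2)\<^sup>2"
      unfolding Q_def by (simp add: power2_eq_square algebra_simps)
    then have "4 * r * Q 0 = (2 * r * w n $ 1 + (s - p) * w n $ 2)\<^sup>2 + \<delta> * (w n $ 2)\<^sup>2"
      unfolding qr \<delta>_def Q0[of n] by (simp add: power2_eq_square algebra_simps)
    then have "\<delta> * (w n $ 2)\<^sup>2 \<le> \<bar>4 * r * Q 0\<bar>"
      using zero_le_power2[of "2 * r * w n $ 1 + (s - p) * w n $ 2"] by linarith
    then show "(w n $ 2)\<^sup>2 \<le> \<bar>4 * r * Q 0\<bar> / \<delta>" using \<delta> by (simp add: pos_le_divide_eq mult.commute)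
    have "- (4 * q * Q n) = (2 * q * w n $ 2 - (s - p) * w n $ 1)\<^sup>2 - ((s - p)\<^sup>2 + 4 * (q * r)) * (w n $ 1)\<^sup>2"
      unfolding Q_def by (simp add: power2_eq_square algebra_simps)
    then have "- (4 * q * Q 0) = (2 * q * w n $ 2 - (s - p) * w n $ 1)\<^sup>2 + \<delta> * (w n $ 1)\<^sup>2"
      unfolding qr \<delta>_def Q0[of n] by (simp add: power2_eq_square algebra_simps)
    then have "\<delta> * (w n $ 1)\<^sup>2 \<le> \<bar>4 * q * Q 0\<bar>"
      using zero_le_power2[of "2 * q * w n $ 2 - (s - p) * w n $ 1"] by linarith
    then show "(w n $ 1)\<^sup>2 \<le> \<bar>4 * q * Q 0\<bar> / \<delta>" using \<delta> by (simp add: pos_le_divide_eq mult.commute)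
  qed
  define M1 where "M1 = sqrt (\<bar>4 * q * Q 0\<bar> / \<delta>)"
  define M2 where "M2 = sqrt (\<bar>4 * r * Q 0\<bar> / \<delta>)"
  have m1: "\<bar>w n $ 1\<bar> \<le> M1" and m2: "\<bar>w n $ 2\<bar> \<le> M2" for n
    unfolding M1_def M2_def using real_sqrt_le_mono[OF b1[of n]] real_sqrt_le_mono[OF b2[of n]] by auto
  obtain K where K: "\<And>t. norm (Z t) \<le> K" using circle_fun_norm_bound[OF Z(1,2)] by blast
  have ZK: "\<bar>Z t $ i $ j\<bar> \<le> K" for t i j
  proof -
    have "norm (Z t $ i) \<le> norm (Z t)" by (rule Finite_Cartesian_Product.norm_nth_le)
    then show ?thesis using component_le_norm_cart[of "Z t $ i" j] K[of t] by linarith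
  qed
  show ?thesis
  proof (intro exI allI)
    fix n
    have "\<bar>X n $ 1\<bar> \<le> \<bar>W n $ 1 $ 1\<bar> * \<bar>w n $ 1\<bar> + \<bar>W n $ 1 $ 2\<bar> * \<bar>w n $ 2\<bar>"
      unfolding Xw matrix_vector_2 abs_mult[symmetric] by (rule abs_triangle_ineq)
    also have "\<dots> \<le> K * M1 + K * M2"
      unfolding W_def using order_trans[OF abs_ge_zero ZK]
      by (intro add_mono mult_mono ZK m1 m2) auto
    finally show "\<bar>X n $ 1\<bar> \<le> K * M1 + K * M2" .
  qed
qed

lemma real_eigenvector:
  fixes B :: "real^2^2"
  assumes "det B = 1" "\<mu>\<^sup>2 - (B$1$1 + B$2$2) * \<mu> + 1 = 0"
  obtains e where "e \<noteq> 0" "B *v e = \<mu> *s e"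
proof -
  have "det (B - mat \<mu>) = \<mu>\<^sup>2 - (B$1$1 + B$2$2) * \<mu> + det B"
    by (simp add: det_2 mat_def power2_eq_square algebra_simps)
  then have "det (B - mat \<mu>) = 0" using assms by simp
  then have "\<not> invertible (B - mat \<mu>)" by (simp add: invertible_det_nz)
  then obtain e where e: "e \<noteq> 0" "(B - mat \<mu>) *v e = 0"
    unfolding invertible_left_inverse matrix_left_invertible_ker by blast
  have "B *v e = \<mu> *s e"
    using e(2) by (simp add: vec_eq_iff forall_2 matrix_vector_2 mat_def algebra_simps)
  then show thesis using e(1) that by blast
qed

text \<open>
  An eigenvector of the constant matrix becomes a continuous section that the cocycle multiplies
  by the eigenvalue: a Floquet solution along every orbit.
\<close>

lemma reducible_eigenvector:
  fixes Z :: "real \<Rightarrow> real^2^2" and B :: "real^2^2"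
  assumes Z: "circle_fun Z" "continuous_on UNIV Z" "\<And>t. det (Z t) = 1"
    and conj: "\<And>t. schrodinger_cocycle a V t ** Z t = Z (t + \<alpha>) ** B"
    and e: "e \<noteq> 0" "B *v e = \<mu> *s e" and f_def: "\<And>t. f t = Z t *v e"
  shows "circle_fun f" "continuous_on UNIV f" "f t \<noteq> 0"
    "\<mu> * f (t + \<alpha>) $ 1 = (a - V t) * f t $ 1 - f t $ 2" "\<mu> * f (t + \<alpha>) $ 2 = f t $ 1"
proof -
  show "circle_fun f" using Z(1) by (simp add: circle_fun_def f_def)
  have "f = (\<lambda>t. \<chi> i. Z t $ i $ 1 * e $ 1 + Z t $ i $ 2 * e $ 2)"
    by (auto simp: f_def vec_eq_iff matrix_vector_2)
  then show "continuous_on UNIV f" by (auto intro!: continuous_intros Z(2))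
  show "f t \<noteq> 0"
    using Z(3)[of t] e(1) invertible_det_nz[of "Z t"]
    unfolding f_def invertible_left_inverse matrix_left_invertible_ker by auto
  have "schrodinger_cocycle a V t *v f t = \<mu> *s f (t + \<alpha>)"
    unfolding f_def matrix_vector_mul_assoc conj
    by (simp add: e(2) matrix_vector_mult_scaleR flip: matrix_vector_mul_assoc)
       (simp add: vec_eq_iff matrix_vector_2 algebra_simps)
  then have m: "\<mu> *s f (t + \<alpha>) = vector [(a - V t) * f t $ 1 - f t $ 2, f t $ 1]"
    unfolding schrodinger_cocycle_mult by (rule sym)
  show "\<mu> * f (t + \<alpha>) $ 1 = (a - V t) * f t $ 1 - f t $ 2"
    using arg_cong[OF m, of "\<lambda>x. x $ 1"] by simp
  show "\<mu> * f (t + \<alpha>) $ 2 = f t $ 1"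
    using arg_cong[OF m, of "\<lambda>x. x $ 2"] by simp
qed

text \<open>
  The three cases are the elliptic, parabolic (including \<open>B\<close> equal to plus or minus the identity)
  and hyperbolic constant matrices, according to the size of the trace.
\<close>

lemma reducible_trichotomy:
  fixes V :: "real \<Rightarrow> real" and \<phi> :: real
  assumes red: "reducible_cocycle (schrodinger_cocycle a V) \<omega>" and V: "\<And>t. \<bar>V t\<bar> \<le> C"
  defines "v \<equiv> \<lambda>n. V (2 * pi * \<omega> * real_of_int n + \<phi>)"
  shows "(\<exists>K. \<forall>n. cmod (fundamental_solution v a n) \<le> K)
    \<or> (\<exists>s\<in>{1, -1}. \<exists>f. twisted_eigenfunction s (2 * pi * \<omega>) V a f)
    \<or> complex_of_real a \<in> ell2_resolvent_set (jacobi v)"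
proof -
  define \<alpha> where "\<alpha> = 2 * pi * \<omega>"
  obtain B Z where B: "det B = 1" and Z: "circle_fun Z" "continuous_on UNIV Z" "\<And>t. det (Z t) = 1"
    and conj: "\<And>t. schrodinger_cocycle a V t ** Z t = Z (t + \<alpha>) ** B"
    using red unfolding reducible_cocycle_def SL2_def \<alpha>_def by blast
  define \<theta> where "\<theta> = (\<lambda>n. \<alpha> * real_of_int n + \<phi>)"
  have \<theta>1: "\<theta> (n + 1) = \<theta> n + \<alpha>" for n by (simp add: \<theta>_def algebra_simps)
  have v\<theta>: "v n = V (\<theta> n)" for n by (simp add: v_def \<theta>_def \<alpha>_def)
  define t where "t = B$1$1 + B$2$2"
  consider "\<bar>t\<bar> < 2" | "\<bar>t\<bar> = 2" | "\<bar>t\<bar> > 2" by linarith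
  then show ?thesis
  proof cases
    case 1
    define u where "u = fundamental_solution v a"
    have us: "u (n + 1) = complex_of_real (a - V (\<theta> n)) * u n - u (n - 1)" for n
      using fundamental_solution_solves[of v a n] unfolding u_def[symmetric] jacobi_def v\<theta>
      by (simp add: algebra_simps eq_neg_iff_add_eq_0)
    have bdd: "\<exists>K. \<forall>n. \<bar>x n\<bar> \<le> K" if x: "\<And>n. x (n + 1) = (a - V (\<theta> n)) * x n - x (n - 1)" for x :: "int \<Rightarrow> real"
    proof -
      define X :: "int \<Rightarrow> real^2" where "X = (\<lambda>n. vector [x n, x (n - 1)])"
      have "X (n + 1) = schrodinger_cocycle a V (\<alpha> * of_int n + \<phi>) *v X n" for n
        unfolding schrodinger_cocycle_mult X_def using x[of n]
        by (simp add: vec_eq_iff forall_2 \<theta>_def)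
      from elliptic_reducible_bounded[OF B _ Z conj this] 1 t_def
      have "\<exists>K. \<forall>n. \<bar>X n $ 1\<bar> \<le> K" by blast
      then show ?thesis by (simp add: X_def)
    qed
    have "Re (u (n + 1)) = (a - V (\<theta> n)) * Re (u n) - Re (u (n - 1))"
      and "Im (u (n + 1)) = (a - V (\<theta> n)) * Im (u n) - Im (u (n - 1))" for n
      unfolding us by simp_all
    then obtain K1 K2 where "\<And>n. \<bar>Re (u n)\<bar> \<le> K1" "\<And>n. \<bar>Im (u n)\<bar> \<le> K2"
      using bdd[of "\<lambda>n. Re (u n)"] bdd[of "\<lambda>n. Im (u n)"] by blast
    then have "cmod (u n) \<le> K1 + K2" for n
      using cmod_le[of "u n"] by (meson add_mono order_trans)
    then show ?thesis unfolding u_def by blast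
  next
    case 2
    define s where "s = t / 2"
    have s: "s = 1 \<or> s = -1" using 2 by (auto simp: s_def abs_if split: if_splits)
    have "s\<^sup>2 - (B$1$1 + B$2$2) * s + 1 = 0" using s unfolding t_def[symmetric] s_def by auto
    then obtain e where e: "e \<noteq> 0" "B *v e = s *s e" using real_eigenvector[OF B] by blast
    define f where "f = (\<lambda>t. Z t *v e)"
    have fZ: "f t = Z t *v e" for t by (simp add: f_def)
    note R = reducible_eigenvector[OF Z conj e fZ]
    \<comment> \<open>The second component is a translate of the first, so the first order system for \<open>f\<close> becomes
      the second order equation of a twisted eigenfunction; here \<open>s\<close> is its own inverse.\<close>
    have f2: "f t $ 2 = s * f (t - \<alpha>) $ 1" for t
      using R(5)[of "t - \<alpha>"] s by auto
    have "twisted_eigenfunction s \<alpha> V a (\<lambda>t. f t $ 1)"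
      unfolding twisted_eigenfunction_def
    proof (intro conjI allI)
      show "circle_fun (\<lambda>t. f t $ 1)" using R(1) by (simp add: circle_fun_def)
      show "continuous_on UNIV (\<lambda>t. f t $ 1)" using R(2) by (intro continuous_intros)
      show "\<exists>\<theta>. f \<theta> $ 1 \<noteq> 0"
      proof (rule ccontr)
        assume "\<not> ?thesis"
        then have "f 0 $ 1 = 0" "f 0 $ 2 = 0" using f2 by auto
        then show False using R(3)[of 0] by (simp add: vec_eq_iff forall_2)
      qed
      fix t
      show "s * (f (t + \<alpha>) $ 1 + f (t - \<alpha>) $ 1) + V t * f t $ 1 = a * f t $ 1"
        using R(4)[of t] f2[of t] by (simp add: algebra_simps)
    qed
    then show ?thesis using s unfolding \<alpha>_def by blast
  next
    case 3
    \<comment> \<open>Both \<open>\<mu>\<close> and its inverse are eigenvalues of \<open>B\<close>, and \<open>\<bar>\<mu>\<bar> \<noteq> 1\<close>.\<close>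
    define \<mu> where "\<mu> = (t + sqrt (t\<^sup>2 - 4)) / 2"
    have t4: "t\<^sup>2 > 4"
      using 3 power_strict_mono[of 2 "\<bar>t\<bar>" 2] by simp
    have \<mu>: "\<mu>\<^sup>2 - t * \<mu> + 1 = 0"
    proof -
      have "(sqrt (t\<^sup>2 - 4))\<^sup>2 = t\<^sup>2 - 4" using t4 by simp
      then show ?thesis unfolding \<mu>_def by (simp add: power2_eq_square field_simps)
    qed
    have \<mu>0: "\<mu> \<noteq> 0" using \<mu> by auto
    have \<mu>1: "\<bar>\<mu>\<bar> \<noteq> 1"
    proof
      assume "\<bar>\<mu>\<bar> = 1"
      then have "\<mu> = 1 \<or> \<mu> = -1" by linarith
      then have "\<bar>t\<bar> = 2" using \<mu> by auto
      then show False using 3 by simp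
    qed
    have i\<mu>: "(inverse \<mu>)\<^sup>2 - t * inverse \<mu> + 1 = 0"
    proof -
      have "(inverse \<mu>)\<^sup>2 - t * inverse \<mu> + 1 = (\<mu>\<^sup>2 - t * \<mu> + 1) / \<mu>\<^sup>2"
        using \<mu>0 by (simp add: field_simps power2_eq_square)
      then show ?thesis using \<mu> by simp
    qed
    obtain e where e: "e \<noteq> 0" "B *v e = \<mu> *s e"
      using real_eigenvector[OF B] \<mu> unfolding t_def by blast
    obtain e' where e': "e' \<noteq> 0" "B *v e' = inverse \<mu> *s e'"
      using real_eigenvector[OF B] i\<mu> unfolding t_def by blast
    define f where "f = (\<lambda>t. Z t *v e)"
    define g where "g = (\<lambda>t. Z t *v e')"
    have fZ: "f t = Z t *v e" and gZ: "g t = Z t *v e'" for t by (simp_all add: f_def g_def)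
    note F = reducible_eigenvector[OF Z conj e fZ]
    note G = reducible_eigenvector[OF Z conj e' gZ]
    define D where "D = e $ 1 * e' $ 2 - e $ 2 * e' $ 1"
    have det: "f t $ 1 * g t $ 2 - f t $ 2 * g t $ 1 = D" for t
    proof -
      have "f t $ 1 * g t $ 2 - f t $ 2 * g t $ 1 = det (Z t) * D"
        unfolding f_def g_def matrix_vector_2 det_2 D_def by (simp add: algebra_simps)
      then show ?thesis using Z(3) by simp
    qed
    have D: "D \<noteq> 0"
    proof
      assume D0: "D = 0"
      have "\<exists>k. e' = k *s e"
      proof (cases "e $ 1 = 0")
        case True
        then have "e $ 2 \<noteq> 0" using e(1) by (simp add: vec_eq_iff forall_2)
        then show ?thesis using D0 True
          by (intro exI[of _ "e' $ 2 / e $ 2"]) (simp add: vec_eq_iff forall_2 D_def field_simps)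
      next
        case False
        then show ?thesis using D0
          by (intro exI[of _ "e' $ 1 / e $ 1"]) (simp add: vec_eq_iff forall_2 D_def field_simps)
      qed
      then obtain k where k: "e' = k *s e" by blast
      have "B *v e' = k *s (B *v e)"
        unfolding k by (simp add: vec_eq_iff forall_2 matrix_vector_2 algebra_simps)
      then have "B *v e' = \<mu> *s e'" by (simp add: e(2) k vec_eq_iff)
      then have "\<mu> *s e' = inverse \<mu> *s e'" using e'(2) by (rule trans[OF sym])
      then have "\<mu> = inverse \<mu>" using e'(1) by (metis vector_mul_rcancel)
      then have "\<mu>\<^sup>2 = 1" using \<mu>0 by (simp add: power2_eq_square field_simps)
      then show False using \<mu>1 by (simp add: power2_eq_1_iff abs_if split: if_splits)
    qed
    obtain K1 where K1: "\<And>t. norm (f t) \<le> K1" using circle_fun_norm_bound[OF F(1,2)] by blast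
    obtain K2 where K2: "\<And>t. norm (g t) \<le> K2" using circle_fun_norm_bound[OF G(1,2)] by blast
    have bf: "cmod (complex_of_real (f t $ i)) \<le> max K1 K2" for t i
      using component_le_norm_cart[of "f t" i] K1[of t] by simp
    have bg: "cmod (complex_of_real (g t $ i)) \<le> max K1 K2" for t i
      using component_le_norm_cart[of "g t" i] K2[of t] by simp
    have "complex_of_real a \<in> ell2_resolvent_set (jacobi v)"
    proof (rule floquet_pair_resolvent[where
          ?f1.0 = "\<lambda>n. complex_of_real (f (\<theta> n) $ 1)" and ?f2.0 = "\<lambda>n. complex_of_real (f (\<theta> n) $ 2)"
          and ?g1.0 = "\<lambda>n. complex_of_real (g (\<theta> n) $ 1)" and ?g2.0 = "\<lambda>n. complex_of_real (g (\<theta> n) $ 2)"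
          and \<beta> = "complex_of_real \<mu>" and D = "complex_of_real D" and K = "max K1 K2" and C = C])
      fix n
      show "\<bar>v n\<bar> \<le> C" unfolding v_def by (rule V)
      show "complex_of_real \<mu> * complex_of_real (f (\<theta> (n + 1)) $ 1) =
          complex_of_real (a - v n) * complex_of_real (f (\<theta> n) $ 1) - complex_of_real (f (\<theta> n) $ 2)"
        using F(4)[of "\<theta> n"] unfolding \<theta>1 v\<theta> by (metis of_real_mult of_real_diff)
      show "complex_of_real \<mu> * complex_of_real (f (\<theta> (n + 1)) $ 2) = complex_of_real (f (\<theta> n) $ 1)"
        using F(5)[of "\<theta> n"] unfolding \<theta>1 by (metis of_real_mult)
      have "g (\<theta> n + \<alpha>) $ 1 = \<mu> * ((a - V (\<theta> n)) * g (\<theta> n) $ 1 - g (\<theta> n) $ 2)"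
        using G(4)[of "\<theta> n"] \<mu>0 by (simp add: field_simps)
      then show "complex_of_real (g (\<theta> (n + 1)) $ 1) = complex_of_real \<mu> *
          (complex_of_real (a - v n) * complex_of_real (g (\<theta> n) $ 1) - complex_of_real (g (\<theta> n) $ 2))"
        unfolding \<theta>1 v\<theta> by (metis of_real_mult of_real_diff)
      have "g (\<theta> n + \<alpha>) $ 2 = \<mu> * g (\<theta> n) $ 1"
        using G(5)[of "\<theta> n"] \<mu>0 by (simp add: field_simps)
      then show "complex_of_real (g (\<theta> (n + 1)) $ 2) = complex_of_real \<mu> * complex_of_real (g (\<theta> n) $ 1)"
        unfolding \<theta>1 by (metis of_real_mult)
      show "complex_of_real (f (\<theta> n) $ 1) * complex_of_real (g (\<theta> n) $ 2)
          - complex_of_real (f (\<theta> n) $ 2) * complex_of_real (g (\<theta> n) $ 1) = complex_of_real D"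
        using det[of "\<theta> n"] by (metis of_real_mult of_real_diff)
    qed (use \<mu>0 \<mu>1 D bf bg in auto)
    then show ?thesis by blast
  qed
qed

section \<open>Energies with unbounded solutions form a dense set\<close>

text \<open>
  Between a point of the set and a nearby point outside lies an edge of a gap: the last point
  of the set on the way.
\<close>

lemma gap_edge_near:
  fixes S :: "real set"
  assumes S: "closed S" "interior S = {}" and x: "x \<in> S" and e: "e > 0"
  shows "\<exists>a\<in>S. dist a x < e \<and> (\<exists>s\<in>{1, -1}. \<exists>r>0. \<forall>t. \<bar>t\<bar> < r \<longrightarrow> a + s * r + t \<notin> S)"
proof -
  have "\<not> ball x e \<subseteq> S"
  proof
    assume "ball x e \<subseteq> S"
    then have "x \<in> interior S" using e by (intro interiorI[of "ball x e"]) auto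
    then show False using S by simp
  qed
  then obtain y where y: "y \<notin> S" "dist x y < e" by (metis mem_ball subsetI)
  then consider "x < y" | "y < x" using x by (metis linorder_neqE_linordered_idom)
  then show ?thesis
  proof cases
    case 1
    define T where "T = S \<inter> {x..y}"
    have T: "closed T" "T \<noteq> {}" "bdd_above T" using S x 1 by (auto simp: T_def intro!: closed_Int)
    define a where "a = Sup T"
    have aT: "a \<in> T" unfolding a_def by (rule closed_contains_Sup[OF T(2,3,1)])
    then have a: "a \<in> S" "x \<le> a" "a < y" using y(1) by (auto simp: T_def less_le)
    have "a + 1 * ((y - a) / 2) + t \<notin> S" if t: "\<bar>t\<bar> < (y - a) / 2" for t
    proof
      assume "a + 1 * ((y - a) / 2) + t \<in> S"
      moreover have "a < a + 1 * ((y - a) / 2) + t" "a + 1 * ((y - a) / 2) + t < y"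
        using t by (auto simp: abs_less_iff field_simps)
      ultimately have "a + 1 * ((y - a) / 2) + t \<in> T" using a by (auto simp: T_def)
      then have "a + 1 * ((y - a) / 2) + t \<le> a" unfolding a_def by (rule cSup_upper[OF _ T(3)])
      then show False using \<open>a < a + 1 * ((y - a) / 2) + t\<close> by linarith
    qed
    then show ?thesis using a y(2)
      by (intro bexI[of _ a] conjI bexI[of _ 1] exI[of _ "(y - a) / 2"]) (auto simp: dist_real_def)
  next
    case 2
    define T where "T = S \<inter> {y..x}"
    have T: "closed T" "T \<noteq> {}" "bdd_below T" using S x 2 by (auto simp: T_def intro!: closed_Int)
    define a where "a = Inf T"
    have aT: "a \<in> T" unfolding a_def by (rule closed_contains_Inf[OF T(2,3,1)])
    then have a: "a \<in> S" "a \<le> x" "y < a" using y(1) by (auto simp: T_def less_le)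
    have "a + (-1) * ((a - y) / 2) + t \<notin> S" if t: "\<bar>t\<bar> < (a - y) / 2" for t
    proof
      assume "a + (-1) * ((a - y) / 2) + t \<in> S"
      moreover have "a + (-1) * ((a - y) / 2) + t < a" "y < a + (-1) * ((a - y) / 2) + t"
        using t by (auto simp: abs_less_iff field_simps)
      ultimately have "a + (-1) * ((a - y) / 2) + t \<in> T" using a by (auto simp: T_def)
      then have "a \<le> a + (-1) * ((a - y) / 2) + t" unfolding a_def by (rule cInf_lower[OF _ T(3)])
      then show False using \<open>a + (-1) * ((a - y) / 2) + t < a\<close> by linarith
    qed
    then show ?thesis using a y(2)
      by (intro bexI[of _ a] conjI bexI[of _ "-1"] exI[of _ "(a - y) / 2"]) (auto simp: dist_real_def)
  qed
qed

lemma dense_gdelta_avoiding_countable: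
  fixes S :: "real set" and U :: "nat \<Rightarrow> real set"
  assumes S: "closed S" "\<And>x. x \<in> S \<Longrightarrow> x islimpt S" and P: "countable P"
    and U: "\<And>N. openin (top_of_set S) (U N)" "\<And>N. S \<subseteq> closure (U N)"
  defines "G \<equiv> (\<Inter>N. U N) - P"
  shows "gdelta_in (top_of_set S) G" "top_of_set S closure_of G = S"
proof -
  define \<G> where "\<G> = range U \<union> (\<lambda>p. S - {p}) ` P"
  have US: "U N \<subseteq> S" for N using openin_imp_subset[OF U(1)] .
  have G: "G = \<Inter>\<G>" unfolding \<G>_def G_def using US by blast
  have c: "countable \<G>" using P by (auto simp: \<G>_def)
  have op: "openin (top_of_set S) T \<and> S \<subseteq> closure T" if "T \<in> \<G>" for T
  proof -
    have "openin (top_of_set S) (S - {p})" for p by (rule openin_delete) simp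
    moreover have "S \<subseteq> closure (S - {p})" for p
    proof
      fix x assume "x \<in> S"
      then show "x \<in> closure (S - {p})"
        using S(2)[of x] closure_subset[of "S - {p}"] by (cases "x = p") (auto simp: islimpt_in_closure)
    qed
    ultimately show ?thesis using that U unfolding \<G>_def by blast
  qed
  have ne: "\<G> \<noteq> {}" by (simp add: \<G>_def)
  show "gdelta_in (top_of_set S) G" unfolding G
    by (rule gdelta_in_Inter[OF c ne]) (use op open_imp_gdelta_in in blast)
  have "S \<subseteq> closure G" unfolding G by (rule Baire[OF S(1) c op])
  moreover have "G \<subseteq> S" using US by (auto simp: G_def)
  ultimately show "top_of_set S closure_of G = S"
    by (auto simp: closure_of_subtopology Int_absorb1)
qed

lemma strip_space_continuous:
  assumes "\<rho> > 0" "V \<in> analytic_strip_space \<rho>"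
  shows "circle_fun V" "continuous_on UNIV V"
proof -
  show "circle_fun V" using assms(2) by (simp add: analytic_strip_space_def)
  obtain F where F: "F holomorphic_on strip \<rho>" "\<And>t. F (complex_of_real t) = complex_of_real (V t)"
    using assms(2) unfolding analytic_strip_space_def is_strip_extension_def by blast
  have "continuous_on UNIV (\<lambda>t. Re (F (complex_of_real t)))"
    by (intro continuous_intros continuous_on_compose2[OF holomorphic_on_imp_continuous_on[OF F(1)]])
       (use assms(1) in \<open>auto simp: strip_def\<close>)
  then show "continuous_on UNIV V" by (simp add: F(2))
qed

text \<open>
  \<open>U N\<close> is open by continuity of the solutions in the energy, and dense because it contains every
  gap edge. An energy in all \<open>U N\<close> has an unbounded solution, which excludes elliptic
  reducibility; \<open>P\<close> removes the parabolic energies, and the hyperbolic ones are not in the spectrum.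
\<close>

lemma cantor_spectrum_generic_nonreducible:
  fixes V :: "real \<Rightarrow> real"
  assumes per: "circle_fun V" and cont: "continuous_on UNIV V"
    and cantor: "cantor_set (schrodinger_spectrum V \<omega> \<phi>)"
  shows "\<exists>G. gdelta_in (top_of_set (schrodinger_spectrum V \<omega> \<phi>)) G \<and>
         top_of_set (schrodinger_spectrum V \<omega> \<phi>) closure_of G = schrodinger_spectrum V \<omega> \<phi> \<and>
         (\<forall>a\<in>G. \<not> reducible_cocycle (schrodinger_cocycle a V) \<omega>)"
proof -
  obtain C where C: "\<And>t. \<bar>V t\<bar> \<le> C" using circle_fun_norm_bound[OF per cont] by auto
  define v where "v = (\<lambda>n. V (2 * pi * \<omega> * real_of_int n + \<phi>))"
  define S where "S = schrodinger_spectrum V \<omega> \<phi>"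
  have op: "schrodinger_op V \<omega> \<phi> = jacobi v" by (intro ext) (simp add: schrodinger_op_def jacobi_def v_def)
  have S: "a \<in> S \<longleftrightarrow> complex_of_real a \<notin> ell2_resolvent_set (jacobi v)" for a
    by (simp add: S_def schrodinger_spectrum_def ell2_spectrum_def op)
  have clS: "closed S" and perf: "\<And>x. x \<in> S \<Longrightarrow> x islimpt S" and intS: "interior S = {}"
    using cantor unfolding cantor_set_def S_def[symmetric]
    by (auto simp: compact_imp_closed closure_closed)
  define P where "P = (\<Union>s\<in>{1, -1::real}. {a. \<exists>f. twisted_eigenfunction s (2 * pi * \<omega>) V a f})"
  have P: "countable P" unfolding P_def by (intro countable_UN countable_twisted_eigenvalues) auto
  define U where "U = (\<lambda>N::nat. {a\<in>S. \<exists>n. cmod (fundamental_solution v a n) > real N})"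
  have Uopen: "openin (top_of_set S) (U N)" for N
  proof -
    have "open {a. real N < cmod (fundamental_solution v a n)}" for n
      by (intro open_Collect_less continuous_intros continuous_fundamental_solution)
    then have "open (\<Union>n. {a. real N < cmod (fundamental_solution v a n)})" by blast
    moreover have "U N = S \<inter> (\<Union>n. {a. real N < cmod (fundamental_solution v a n)})" by (auto simp: U_def)
    ultimately show ?thesis by (auto simp: openin_open)
  qed
  have Udense: "S \<subseteq> closure (U N)" for N
  proof
    fix x assume x: "x \<in> S"
    show "x \<in> closure (U N)" unfolding closure_approachable
    proof (intro allI impI)
      fix e :: real assume "e > 0"
      then obtain a s r where a: "a \<in> S" "dist a x < e" and s: "s = 1 \<or> s = -1" and r: "r > 0"
        and gap: "\<And>t. \<bar>t\<bar> < r \<Longrightarrow> a + s * r + t \<notin> S"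
        using gap_edge_near[OF clS intS x] by blast
      have "\<not> (\<forall>n. cmod (fundamental_solution v a n) \<le> real N)"
      proof
        assume b: "\<forall>n. cmod (fundamental_solution v a n) \<le> real N"
        show False
        proof (rule bounded_solution_excludes_gap_edge[OF _ fundamental_solution_solves fundamental_solution_wronskian _ s r])
          show "\<bar>v n\<bar> \<le> C" for n unfolding v_def by (rule C)
          show "cmod (fundamental_solution v a n) \<le> real N" for n using b by blast
          show "complex_of_real (a + s * r + t) \<in> ell2_resolvent_set (jacobi v)" if "\<bar>t\<bar> < r" for t
            using gap[OF that] S by blast
        qed
      qed
      then have "a \<in> U N" using a(1) by (auto simp: U_def not_le)
      then show "\<exists>y\<in>U N. dist y x < e" using a(2) by blast
    qed
  qed
  have "\<not> reducible_cocycle (schrodinger_cocycle a V) \<omega>" if a: "a \<in> (\<Inter>N. U N) - P" for a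
  proof
    assume red: "reducible_cocycle (schrodinger_cocycle a V) \<omega>"
    have "complex_of_real a \<notin> ell2_resolvent_set (jacobi v)" using a S by (auto simp: U_def)
    moreover have "\<not> (\<exists>s\<in>{1, -1}. \<exists>f. twisted_eigenfunction s (2 * pi * \<omega>) V a f)"
      using a by (auto simp: P_def)
    ultimately obtain K where K: "\<And>n. cmod (fundamental_solution v a n) \<le> K"
      using reducible_trichotomy[OF red C, of \<phi>] unfolding v_def[symmetric] by blast
    obtain N :: nat where "K < real N" using reals_Archimedean2 by blast
    moreover obtain n where "cmod (fundamental_solution v a n) > real N" using a by (auto simp: U_def)
    ultimately show False using K[of n] by linarith
  qed
  then show ?thesis
    using dense_gdelta_avoiding_countable[of S P U, OF clS perf P Uopen Udense]
    unfolding S_def[symmetric] by blast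
qed

theorem theorem5:
  fixes \<rho> :: real
  assumes "\<rho> > 0"
  shows "\<exists>\<epsilon>>0. \<forall>\<omega> V \<phi>.
    diophantine \<omega> \<longrightarrow> V \<in> analytic_strip_space \<rho> \<longrightarrow> strip_norm \<rho> V < \<epsilon> \<longrightarrow>
    cantor_set (schrodinger_spectrum V \<omega> \<phi>) \<longrightarrow>
    (\<exists>G. gdelta_in (top_of_set (schrodinger_spectrum V \<omega> \<phi>)) G \<and>
         top_of_set (schrodinger_spectrum V \<omega> \<phi>) closure_of G = schrodinger_spectrum V \<omega> \<phi> \<and>
         (\<forall>a\<in>G. \<not> reducible_cocycle (schrodinger_cocycle a V) \<omega>))"
proof (rule exI[of _ 1], intro conjI allI impI)
  fix \<omega> V \<phi>
  assume "V \<in> analytic_strip_space \<rho>" and "cantor_set (schrodinger_spectrum V \<omega> \<phi>)"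
  then show "\<exists>G. gdelta_in (top_of_set (schrodinger_spectrum V \<omega> \<phi>)) G \<and>
         top_of_set (schrodinger_spectrum V \<omega> \<phi>) closure_of G = schrodinger_spectrum V \<omega> \<phi> \<and>
         (\<forall>a\<in>G. \<not> reducible_cocycle (schrodinger_cocycle a V) \<omega>)"
    using strip_space_continuous[OF assms] cantor_spectrum_generic_nonreducible by blast
qed simp

end
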